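(* Let $G$ be an infinitesimal generator in $\mathbb{D}$, let $(\phi_t)_{t\ge0}$ be the associated semigroup of holomorphic self-maps of $\mathbb{D}$, and let $x\in\partial\mathbb{D}$. The following are equivalent: (1) $\limsup_{(0,1)\ni r\to1}|G(rx)|(1-r)>0$; (2) $x$ is a regular pole of $G$; (3) $x$ is a $\beta$-point of $\phi_t$ for some (equivalently, for all) $t>0$; (4) for some (equivalently, for all) $t>0$, $\angle\lim_{z\to x}\phi_t'(z)=0$ and $\angle\lim_{z\to x}\phi_t''(z)=L$ exists in $\mathbb{C}$; (5) for some (equivalently, for all) $t>0$, $\lim_{(0,1)\ni r\to1}|\phi_t'(rx)|=0$ and $\limsup_{(0,1)\ni r\to1}|\phi_t''(rx)|<+\infty$; (6) there exists $t_0>0$ such that $\limsup_{(0,1)\ni r\to1}\frac{|\phi_{t_0}'(rx)|}{1-r}<+\infty$. Moreover, if these conditions are satisfied then for all $t>0$: (a) there is $\sigma_t\in\mathbb{D}$ with $\angle\lim_{z\to x}\phi_t(z)=\sigma_t$, and $\angle\lim_{z\to x}\phi_t'(z)=0$; (b) if $A=\angle\lim_{z\to x}G(z)(z-x)$ (so that $x$ is a regular pole of $G$ of mass $|A|$), then $$\angle\lim_{z\to x}\phi_t''(z)=\angle\lim_{z\to x}\frac{\phi_t'(z)}{z-x}=\frac{G(\sigma_t)}{A}.$$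
   Context: $\mathbb{D}$ is the open unit disc in $\mathbb{C}$. A semigroup $(\phi_t)_{t\ge0}$ of holomorphic self-maps of $\mathbb{D}$ is a family of holomorphic maps $\phi_t:\mathbb{D}\to\mathbb{D}$ with $\phi_0=\mathrm{id}$, $\phi_{t+s}=\phi_t\circ\phi_s$, and $t\mapsto\phi_t$ continuous for uniform convergence on compacta. Its infinitesimal generator is the unique holomorphic $G:\mathbb{D}\to\mathbb{C}$ with $\partial_t\phi_t(z)=G(\phi_t(z))$ for all $t\ge 0$, $z\in\mathbb D$; an infinitesimal generator in $\mathbb D$ is a $G$ arising this way. $\angle\lim$, $\angle\liminf$, $\angle\limsup$ as $z\to x\in\partial\mathbb D$ denote non-tangential limit, lower limit and upper limit, i.e. taken as $z\to x$ inside Stolz angles $\{z\in\mathbb{D}:|x-z|<R(1-|z|)\}$, $R>1$. A point $x\in\partial\mathbb{D}$ is a regular pole of $G$ of mass $C>0$ if $\angle\liminf_{z\to x}|G(z)(x-z)|=C$ with $C\in(0,+\infty)$; it is a regular pole if this holds for some such $C$. (For an infinitesimal generator the limit $\angle\lim_{z\to x}G(z)(x-z)$ always exists in $\mathbb{C}$.) For a holomorphic $f:\mathbb{D}\to\mathbb{C}$, a point $x\in\partial\mathbb{D}$ is a $\beta$-point of $f$ if $\angle\limsup_{z\to x}\frac{|f'(z)|}{|x-z|}=L<+\infty$. *)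

theory Defs
  imports "HOL-Complex_Analysis.Complex_Analysis"
begin

(* Functions on the unit disc are total functions on the complex numbers; only their
   values on ball 0 1 matter, and all limits below are taken inside the disc. *)

definition holomorphic_semigroup :: "(real \<Rightarrow> complex \<Rightarrow> complex) \<Rightarrow> bool" where
  "holomorphic_semigroup \<phi> \<longleftrightarrow>
     (\<forall>t\<ge>0. \<phi> t holomorphic_on ball 0 1 \<and> \<phi> t ` ball 0 1 \<subseteq> ball 0 1) \<and>
     (\<forall>z\<in>ball 0 1. \<phi> 0 z = z) \<and>
     (\<forall>t\<ge>0. \<forall>s\<ge>0. \<forall>z\<in>ball 0 1. \<phi> (t + s) z = \<phi> t (\<phi> s z)) \<and>
     (\<forall>K. compact K \<longrightarrow> K \<subseteq> ball 0 1 \<longrightarrow>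
        (\<forall>t\<ge>0. uniform_limit K \<phi> (\<phi> t) (at t within {0..})))"

definition infinitesimal_generator_of ::
    "(real \<Rightarrow> complex \<Rightarrow> complex) \<Rightarrow> (complex \<Rightarrow> complex) \<Rightarrow> bool" where
  "infinitesimal_generator_of \<phi> G \<longleftrightarrow>
     G holomorphic_on ball 0 1 \<and>
     (\<forall>t\<ge>0. \<forall>z\<in>ball 0 1.
        ((\<lambda>s. \<phi> s z) has_vector_derivative G (\<phi> t z)) (at t within {0..}))"

definition stolz_angle :: "complex \<Rightarrow> real \<Rightarrow> complex set" where
  "stolz_angle x R = {z \<in> ball 0 1. norm (x - z) < R * (1 - norm z)}"

definition angular_lim :: "(complex \<Rightarrow> complex) \<Rightarrow> complex \<Rightarrow> complex \<Rightarrow> bool" where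
  "angular_lim f x l \<longleftrightarrow> (\<forall>R>1. (f \<longlongrightarrow> l) (at x within stolz_angle x R))"

(* The lower and upper limits over all Stolz angles at x: the extremal value over the
   apertures R. *)

definition angular_liminf :: "(complex \<Rightarrow> real) \<Rightarrow> complex \<Rightarrow> ereal" where
  "angular_liminf f x =
     (INF R\<in>{1<..}. Liminf (at x within stolz_angle x R) (\<lambda>z. ereal (f z)))"

definition angular_limsup :: "(complex \<Rightarrow> real) \<Rightarrow> complex \<Rightarrow> ereal" where
  "angular_limsup f x =
     (SUP R\<in>{1<..}. Limsup (at x within stolz_angle x R) (\<lambda>z. ereal (f z)))"

definition regular_pole_of_mass :: "(complex \<Rightarrow> complex) \<Rightarrow> complex \<Rightarrow> real \<Rightarrow> bool" where
  "regular_pole_of_mass G x C \<longleftrightarrow>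
     C > 0 \<and> angular_liminf (\<lambda>z. norm (G z * (x - z))) x = ereal C"

definition regular_pole :: "(complex \<Rightarrow> complex) \<Rightarrow> complex \<Rightarrow> bool" where
  "regular_pole G x \<longleftrightarrow> (\<exists>C. regular_pole_of_mass G x C)"

definition beta_point :: "(complex \<Rightarrow> complex) \<Rightarrow> complex \<Rightarrow> bool" where
  "beta_point f x \<longleftrightarrow> angular_limsup (\<lambda>z. norm (deriv f z) / norm (x - z)) x < \<infinity>"

definition all_equivalent :: "bool list \<Rightarrow> bool" where
  "all_equivalent Ps \<longleftrightarrow> (\<forall>P\<in>set Ps. \<forall>Q\<in>set Ps. P \<longleftrightarrow> Q)"

end

theory Submission
  imports Defs
begin

text \<open>
  Differentiating the Schwarz-Pick inequality \<open>\<bar>\<phi>\<^sub>t(z) - \<phi>\<^sub>t(0)\<bar> \<le> \<bar>z\<bar> \<bar>1 - cnj (\<phi>\<^sub>t(0)) \<phi>\<^sub>t(z)\<bar>\<close> at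
  \<open>t = 0\<close> gives \<open>G(z) = a - cnj a z\<^sup>2 - z q(z)\<close> with \<open>Re q \<ge> 0\<close>, and the Julia-Wolff-Caratheodory argument
  for \<open>q\<close> shows that \<open>G(z) (z - x)\<close> has an angular limit \<open>k x\<^sup>2\<close> with \<open>k \<ge> 0\<close>. Each of the listed conditions
  is equivalent to \<open>k > 0\<close>, the link with \<open>\<phi>\<^sub>t\<close> being the identity \<open>\<phi>\<^sub>t' G = G \<circ> \<phi>\<^sub>t\<close>.

  If \<open>k > 0\<close>, then the vector field is so strong near \<open>x\<close> that \<open>\<phi>\<^sub>t\<close> maps the end of a Stolz angle into
  a compact subset of the disc. Hence \<open>\<phi>\<^sub>t' = O(\<bar>z - x\<bar>)\<close> there, so \<open>\<phi>\<^sub>t\<close> has an angular limit \<open>\<sigma>\<close> in the disc and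
  \<open>\<phi>\<^sub>t' / (z - x)\<close> tends to \<open>G(\<sigma>) / (k x\<^sup>2)\<close>. Conversely, if \<open>\<phi>\<^sub>t'(rx) = O(1 - r)\<close>, the radial limit \<open>\<sigma>\<close> exists with
  \<open>\<phi>\<^sub>t(rx) - \<sigma> = O((1 - r)\<^sup>2)\<close>. It is not on the circle because \<open>1 - \<bar>\<phi>\<^sub>t(rx)\<bar>\<close> is at least a multiple of \<open>1 - r\<close>, and it is
  not a zero of \<open>G\<close> because \<open>\<phi>\<^sub>t\<close> is injective; so \<open>G(rx) = G(\<phi>\<^sub>t(rx)) / \<phi>\<^sub>t'(rx)\<close> has order at least \<open>1 / (1 - r)\<close>.
\<close>

subsection \<open>Schwarz-Pick inequalities\<close>

text \<open>Converts pseudo-hyperbolic distances into the factors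
  \<open>1 - (norm z)\<^sup>2\<close>, which measure the approach to the circle. At a unit point the
  last product vanishes.\<close>

lemma norm_one_minus_cnj_mult_sq:
  fixes z w :: complex
  shows "(norm (1 - cnj w * z))\<^sup>2 = (norm (z - w))\<^sup>2 + (1 - (norm z)\<^sup>2) * (1 - (norm w)\<^sup>2)"
  unfolding cmod_power2 by (simp add: power2_eq_square algebra_simps)

lemma norm_one_minus_cnj_mult_unit:
  fixes x z :: complex
  assumes "norm x = 1"
  shows "norm (1 - cnj x * z) = norm (x - z)"
  using norm_one_minus_cnj_mult_sq[where z = z and w = x] assms
  by (simp add: power2_eq_iff_nonneg norm_minus_commute)

lemma one_minus_cnj_mult_nonzero:
  fixes z w :: complex
  assumes "norm z < 1" "norm w \<le> 1"
  shows "1 - cnj w * z \<noteq> 0"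
proof
  assume "1 - cnj w * z = 0"
  then have "norm (cnj w * z) = 1" by (metis eq_iff_diff_eq_0 norm_one)
  moreover have "norm w * norm z \<le> 1 * norm z"
    using assms(2) by (intro mult_right_mono) auto
  ultimately show False using assms by (simp add: norm_mult)
qed

text \<open>Schwarz's lemma for \<open>f\<close> composed with the disc automorphisms that carry 0
  to \<open>w\<close> and \<open>f w\<close> to 0.\<close>

lemma Schwarz_Pick_Moebius:
  assumes f: "f holomorphic_on ball 0 1" "f ` ball 0 1 \<subseteq> ball 0 1"
    and z: "norm z < 1" and w: "norm w < 1"
  shows "norm (Moebius_function 0 (f w) (f z)) \<le> norm (Moebius_function 0 w z)"
proof -
  have fd: "norm (f u) < 1" if "norm u < 1" for u
    using f(2) that by (auto simp: image_subset_iff)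
  let ?g = "Moebius_function 0 (f w) \<circ> (f \<circ> Moebius_function 0 (-w))"
  have mw: "norm (-w) < 1" using w by simp
  have "norm (?g (Moebius_function 0 w z)) \<le> norm (Moebius_function 0 w z)"
  proof (rule Schwarz_Lemma(1))
    show "?g holomorphic_on ball 0 1"
    proof (intro holomorphic_on_compose_gen[where t = "ball 0 1"] Moebius_function_holomorphic f fd w mw)
      show "(f \<circ> Moebius_function 0 (- w)) ` ball 0 1 \<subseteq> ball 0 1"
        using Moebius_function_norm_lt_1[OF mw] fd by auto
      show "Moebius_function 0 (- w) ` ball 0 1 \<subseteq> ball 0 1"
        using Moebius_function_norm_lt_1[OF mw] by auto
    qed
    show "?g 0 = 0"
      by (simp add: Moebius_function_of_zero Moebius_function_eq_zero)
    show "norm (?g u) < 1" if "norm u < 1" for u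
      using Moebius_function_norm_lt_1 mw fd w that by simp
    show "norm (Moebius_function 0 w z) < 1"
      using Moebius_function_norm_lt_1 w z by simp
  qed
  then show ?thesis
    using Moebius_function_compose[of "-w" w z] w z by simp
qed

text \<open>Squaring the invariant form and expanding by \<open>norm_one_minus_cnj_mult_sq\<close>
  cancels the product of the two squared differences. The result is free of division and displays
  the boundary factors of both points.\<close>

lemma Schwarz_Pick:
  assumes f: "f holomorphic_on ball 0 1" "f ` ball 0 1 \<subseteq> ball 0 1"
    and z: "norm z < 1" and w: "norm w < 1"
  shows "(1 - (norm z)\<^sup>2) * (1 - (norm w)\<^sup>2) * (norm (1 - cnj (f w) * f z))\<^sup>2
       \<le> (1 - (norm (f z))\<^sup>2) * (1 - (norm (f w))\<^sup>2) * (norm (1 - cnj w * z))\<^sup>2"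
proof -
  have fd: "norm (f u) < 1" if "norm u < 1" for u
    using f(2) that by (auto simp: image_subset_iff)
  have nz: "1 - cnj w * z \<noteq> 0" "1 - cnj (f w) * f z \<noteq> 0"
    using one_minus_cnj_mult_nonzero fd z w by (auto intro: less_imp_le)
  have "norm (f z - f w) / norm (1 - cnj (f w) * f z) \<le> norm (z - w) / norm (1 - cnj w * z)"
    using Schwarz_Pick_Moebius[OF assms] by (simp add: Moebius_function_simple norm_divide)
  then have "norm (f z - f w) * norm (1 - cnj w * z) \<le> norm (z - w) * norm (1 - cnj (f w) * f z)"
    using nz by (simp add: divide_simps split: if_splits)
  then have "(norm (f z - f w) * norm (1 - cnj w * z))\<^sup>2 \<le> (norm (z - w) * norm (1 - cnj (f w) * f z))\<^sup>2"
    by (intro power_mono) auto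
  then show ?thesis
    unfolding power_mult_distrib norm_one_minus_cnj_mult_sq by (simp add: algebra_simps)
qed

text \<open>The Cayley transform \<open>F\<close> carries the problem to the disc, where
  Schwarz-Pick reads \<open>Z * S\<^sup>2 \<le> 4 * Re (Q w) * D * Re (Q z)\<close>. Since
  \<open>Re (Q z) \<le> S\<close>, one factor \<open>S\<close> cancels. The bound that remains is
  linear in \<open>Re (Q w)\<close>, which can be made small relative to the Poisson kernel by the
  choice of \<open>w\<close>.\<close>

lemma Schwarz_Pick_half_plane:
  fixes Q :: "complex \<Rightarrow> complex"
  assumes Q: "Q holomorphic_on ball 0 1" "\<And>u. norm u < 1 \<Longrightarrow> Re (Q u) > 0"
    and z: "norm z < 1" and w: "norm w < 1"
  shows "norm (Q z + cnj (Q w)) * ((1 - (norm z)\<^sup>2) * (1 - (norm w)\<^sup>2))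
       \<le> 4 * Re (Q w) * (norm (1 - cnj w * z))\<^sup>2"
proof -
  define F where "F u = (Q u - 1) / (Q u + 1)" for u
  have nz: "Q u + 1 \<noteq> 0" if "norm u < 1" for u
    using Q(2)[OF that] by (auto simp: complex_eq_iff)
  have F1: "1 - (norm (F u))\<^sup>2 = 4 * Re (Q u) / (norm (Q u + 1))\<^sup>2" if "norm u < 1" for u
  proof -
    have "(norm (Q u + 1))\<^sup>2 - (norm (Q u - 1))\<^sup>2 = 4 * Re (Q u)"
      unfolding cmod_power2 by (simp add: power2_eq_square algebra_simps)
    then show ?thesis
      using nz[OF that] by (simp add: F_def norm_divide power_divide diff_divide_eq_iff flip: diff_divide_distrib)
  qed
  have Fd: "norm (F u) < 1" if "norm u < 1" for u
  proof -
    have "4 * Re (Q u) / (norm (Q u + 1))\<^sup>2 > 0"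
      using Q(2)[OF that] nz[OF that] by simp
    then have "(norm (F u))\<^sup>2 < 1\<^sup>2" using F1[OF that] by simp
    then show ?thesis by (rule power2_less_imp_less) simp
  qed
  have hol: "F holomorphic_on ball 0 1"
    unfolding F_def using nz by (intro holomorphic_intros Q) auto
  define a where "a = norm (Q z + 1)"
  define b where "b = norm (Q w + 1)"
  define S where "S = norm (Q z + cnj (Q w))"
  have ab: "a > 0" "b > 0" using nz z w by (auto simp: a_def b_def)
  have S: "Re (Q z) \<le> S" "S > 0"
    using complex_Re_le_cmod[of "Q z + cnj (Q w)"] Q(2)[OF z] Q(2)[OF w] by (auto simp: S_def)
  have nzw: "cnj (Q w) + 1 \<noteq> 0"
    using nz[OF w] by (metis complex_cnj_add complex_cnj_one complex_cnj_zero_iff)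
  have bb: "norm (cnj (Q w) + 1) = b"
    by (metis b_def complex_cnj_add complex_cnj_one complex_mod_cnj)
  have "1 - cnj (F w) * F z = 2 * (Q z + cnj (Q w)) / ((Q z + 1) * (cnj (Q w) + 1))"
  proof -
    define N where "N = (cnj (Q w) - 1) * (Q z - 1)"
    define D where "D = (Q z + 1) * (cnj (Q w) + 1)"
    have D: "D \<noteq> 0" using nz[OF z] nzw by (simp add: D_def)
    have "cnj (F w) * F z = N / D" by (simp add: F_def N_def D_def mult.commute)
    moreover have "1 - N / D = 2 * (Q z + cnj (Q w)) / D"
      using D by (simp add: nonzero_eq_divide_eq left_diff_distrib) (simp add: N_def D_def algebra_simps)
    ultimately show ?thesis by (simp only: D_def)
  qed
  then have nF: "norm (1 - cnj (F w) * F z) = 2 * S / (a * b)"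
    by (simp add: norm_divide norm_mult bb a_def S_def del: complex_cnj_add distrib_left_numeral)
  define Z where "Z = (1 - (norm z)\<^sup>2) * (1 - (norm w)\<^sup>2)"
  define D where "D = (norm (1 - cnj w * z))\<^sup>2"
  have "Z * (2 * S / (a * b))\<^sup>2 \<le> (4 * Re (Q z) / a\<^sup>2) * (4 * Re (Q w) / b\<^sup>2) * D"
    using Schwarz_Pick[OF hol _ z w] Fd F1[OF z] F1[OF w]
    by (auto simp: nF Z_def D_def a_def b_def image_subset_iff)
  then have "(Z * (2 * S / (a * b))\<^sup>2) * (a\<^sup>2 * b\<^sup>2) \<le> ((4 * Re (Q z) / a\<^sup>2) * (4 * Re (Q w) / b\<^sup>2) * D) * (a\<^sup>2 * b\<^sup>2)"
    by (intro mult_right_mono) auto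
  then have "Z * S * S \<le> 4 * Re (Q w) * D * Re (Q z)"
    using ab by (simp add: power2_eq_square field_simps)
  also have "\<dots> \<le> 4 * Re (Q w) * D * S"
    using S Q(2)[OF w] by (intro mult_left_mono) (auto simp: D_def)
  finally have "Z * S \<le> 4 * Re (Q w) * D" using S by simp
  then show ?thesis by (simp add: Z_def S_def D_def algebra_simps)
qed

text \<open>Schwarz-Pick with base point 0, combined with
  \<open>norm (1 - cnj (f 0) * f z) \<ge> 1 - norm (f 0)\<close>. Values of a self-map approach the
  circle at most linearly in \<open>1 - norm z\<close>; this later excludes radial limits on the
  circle.\<close>

lemma self_map_boundary_distance:
  assumes f: "f holomorphic_on ball 0 1" "f ` ball 0 1 \<subseteq> ball 0 1"
  obtains \<kappa> where "\<kappa> > 0" "\<And>z. norm z < 1 \<Longrightarrow> \<kappa> * (1 - norm z) \<le> 1 - norm (f z)"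
proof -
  have fd: "norm (f u) < 1" if "norm u < 1" for u
    using f(2) that by (auto simp: image_subset_iff)
  have "(1 - norm (f 0))\<^sup>2 / 2 * (1 - norm z) \<le> 1 - norm (f z)" if z: "norm z < 1" for z
  proof -
    have "norm (cnj (f 0) * f z) \<le> norm (f 0) * 1"
      unfolding norm_mult using fd[OF z] by (intro mult_mono) auto
    moreover have "1 - norm (cnj (f 0) * f z) \<le> norm (1 - cnj (f 0) * f z)"
      using norm_triangle_ineq2[of 1 "cnj (f 0) * f z"] by simp
    ultimately have "(1 - norm (f 0))\<^sup>2 \<le> (norm (1 - cnj (f 0) * f z))\<^sup>2"
      using fd[of 0] by (intro power_mono) auto
    moreover have "1 - norm z \<le> 1 - (norm z)\<^sup>2"
      using z mult_left_mono[of "norm z" 1 "norm z"] by (simp add: power2_eq_square)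
    ultimately have "(1 - norm z) * (1 - norm (f 0))\<^sup>2 \<le> (1 - (norm z)\<^sup>2) * (norm (1 - cnj (f 0) * f z))\<^sup>2"
      using z by (intro mult_mono) (auto simp: power_le_one)
    also have "\<dots> \<le> (1 - (norm (f z))\<^sup>2) * (1 - (norm (f 0))\<^sup>2)"
      using Schwarz_Pick[OF f z, of 0] by simp
    also have "\<dots> \<le> (1 - (norm (f z))\<^sup>2) * 1"
      using fd[OF z] by (intro mult_left_mono) (auto simp: power_le_one)
    also have "\<dots> = (1 - norm (f z)) * (1 + norm (f z))" by (simp add: power2_eq_square algebra_simps)
    also have "\<dots> \<le> (1 - norm (f z)) * 2" using fd[OF z] by (intro mult_left_mono) auto
    finally show ?thesis by (simp add: mult.commute)
  qed
  moreover have "(1 - norm (f 0))\<^sup>2 / 2 > 0" using fd[of 0] by simp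
  ultimately show ?thesis by (rule that[rotated])
qed

lemma compact_subset_unit_ball:
  fixes K :: "complex set"
  assumes "compact K" "K \<subseteq> ball 0 1"
  obtains r where "0 \<le> r" "r < 1" "K \<subseteq> cball 0 r"
proof (cases "K = {}")
  case True
  then show ?thesis using that[of 0] by simp
next
  case False
  have "\<exists>p\<in>K. \<forall>y\<in>K. norm y \<le> norm p"
    by (intro continuous_attains_sup assms False continuous_intros)
  then obtain p where "p \<in> K" "\<And>y. y \<in> K \<Longrightarrow> norm y \<le> norm p" by blast
  then show ?thesis using assms(2) by (intro that[of "norm p"]) auto
qed

subsection \<open>Stolz angles and angular limits\<close>

lemma stolz_angle_iff:
  "z \<in> stolz_angle x R \<longleftrightarrow> norm z < 1 \<and> norm (x - z) < R * (1 - norm z)"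
  by (simp add: stolz_angle_def)

text \<open>A Stolz angle is the disc intersected with a sublevel set of the convex function
  \<open>dist x z + R * dist 0 z\<close>. Convexity turns derivative bounds on the angle into
  Lipschitz bounds.\<close>

lemma convex_stolz_angle:
  assumes "R \<ge> 0"
  shows "convex (stolz_angle x R)"
proof -
  have cv: "convex_on UNIV (\<lambda>z. dist x z + R * dist 0 z)"
    using assms by (intro convex_on_add convex_on_cmul convex_on_dist) auto
  have "convex {z. dist x z + R * dist 0 z < R}"
  proof (rule convexI)
    fix a b and u v :: real
    assume *: "a \<in> {z. dist x z + R * dist 0 z < R}" "b \<in> {z. dist x z + R * dist 0 z < R}"
      and uv: "0 \<le> u" "0 \<le> v" "u + v = 1"
    let ?f = "\<lambda>z. dist x z + R * dist 0 z"
    have "?f (u *\<^sub>R a + v *\<^sub>R b) \<le> u * ?f a + v * ?f b"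
      using cv uv unfolding convex_on_def by blast
    also have "\<dots> < R" using * uv by (intro convex_bound_lt) auto
    finally show "u *\<^sub>R a + v *\<^sub>R b \<in> {z. ?f z < R}" by simp
  qed
  moreover have "stolz_angle x R = ball 0 1 \<inter> {z. dist x z + R * dist 0 z < R}"
    by (auto simp: stolz_angle_def dist_norm algebra_simps)
  ultimately show ?thesis by (simp add: convex_Int)
qed

lemma norm_diff_radius:
  fixes x :: complex
  assumes "norm x = 1" "r \<le> 1"
  shows "norm (x - of_real r * x) = 1 - r"
proof -
  have "x - of_real r * x = of_real (1 - r) * x" by (simp add: algebra_simps)
  then show ?thesis using assms by (simp add: norm_mult del: of_real_diff)
qed

lemma radius_in_stolz_angle:
  assumes "norm x = 1" "0 \<le> r" "r < 1" "R > 1"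
  shows "of_real r * x \<in> stolz_angle x R"
  using assms norm_diff_radius[of x r] by (simp add: stolz_angle_def norm_mult)

lemma eventually_at_left_1: "eventually (\<lambda>r::real. 0 < r \<and> r < 1) (at_left 1)"
  by (rule eventually_at_leftI[of 0]) auto

lemma filterlim_radius:
  assumes "norm x = 1" "R > 1"
  shows "filterlim (\<lambda>r. of_real r * x) (at x within stolz_angle x R) (at_left 1)"
  unfolding filterlim_at
proof
  show "((\<lambda>r. of_real r * x) \<longlongrightarrow> x) (at_left 1)"
    by (auto intro!: tendsto_eq_intros)
  show "\<forall>\<^sub>F r in at_left 1. of_real r * x \<in> stolz_angle x R \<and> of_real r * x \<noteq> x"
    using eventually_at_left_1
  proof eventually_elim
    case (elim r)
    moreover have "of_real r * x \<noteq> x" using assms elim by auto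
    ultimately show ?case using radius_in_stolz_angle assms by auto
  qed
qed

lemma at_within_stolz_angle_neq_bot:
  assumes "norm x = 1" "R > 1"
  shows "at x within stolz_angle x R \<noteq> bot"
  using filterlim_radius[OF assms] filterlim_mono trivial_limit_at_left_real[of "1::real"]
  by (metis filterlim_def filtermap_bot_iff le_bot)

lemma eventually_in_stolz_angle: "eventually (\<lambda>z. z \<in> stolz_angle x R) (at x within stolz_angle x R)"
  by (simp add: eventually_at_filter)

lemma angular_limD: "angular_lim f x l \<Longrightarrow> R > 1 \<Longrightarrow> (f \<longlongrightarrow> l) (at x within stolz_angle x R)"
  by (simp add: angular_lim_def)

lemma angular_lim_radial:
  assumes "angular_lim f x l" "norm x = 1"
  shows "((\<lambda>r. f (of_real r * x)) \<longlongrightarrow> l) (at_left 1)"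
  using filterlim_compose[OF angular_limD[OF assms(1), of 2] filterlim_radius[OF assms(2), of 2]] by simp

lemma angular_limsup_eq:
  assumes "\<And>R. R > 1 \<Longrightarrow> (f \<longlongrightarrow> l) (at x within stolz_angle x R)" "norm x = 1"
  shows "angular_limsup f x = ereal l"
proof -
  have "Limsup (at x within stolz_angle x R) (\<lambda>z. ereal (f z)) = ereal l" if "R > 1" for R
    using assms that at_within_stolz_angle_neq_bot by (intro lim_imp_Limsup) auto
  then show ?thesis by (auto simp: angular_limsup_def)
qed

lemma angular_liminf_eq:
  assumes "\<And>R. R > 1 \<Longrightarrow> (f \<longlongrightarrow> l) (at x within stolz_angle x R)" "norm x = 1"
  shows "angular_liminf f x = ereal l"
proof -
  have "Liminf (at x within stolz_angle x R) (\<lambda>z. ereal (f z)) = ereal l" if "R > 1" for R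
    using assms that at_within_stolz_angle_neq_bot by (intro lim_imp_Liminf) auto
  then show ?thesis by (auto simp: angular_liminf_def)
qed

text \<open>Translates finiteness of an extended-real upper limit into an eventual bound, the form
  in which such conditions enter all estimates.\<close>

lemma Limsup_ereal_finite_iff:
  "Limsup F (\<lambda>z. ereal (f z)) < \<infinity> \<longleftrightarrow> (\<exists>M. eventually (\<lambda>z. f z \<le> M) F)"
proof
  assume "Limsup F (\<lambda>z. ereal (f z)) < \<infinity>"
  then obtain n where "Limsup F (\<lambda>z. ereal (f z)) < ereal (real n)"
    using less_PInf_Ex_of_nat by (metis less_irrefl)
  from Limsup_lessD[OF this] show "\<exists>M. eventually (\<lambda>z. f z \<le> M) F"
    by (intro exI[of _ "real n"]) (auto elim: eventually_mono)
next
  assume "\<exists>M. eventually (\<lambda>z. f z \<le> M) F"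
  then obtain M where "eventually (\<lambda>z. f z \<le> M) F" by blast
  then have "Limsup F (\<lambda>z. ereal (f z)) \<le> ereal M"
    by (intro Limsup_bounded) auto
  then show "Limsup F (\<lambda>z. ereal (f z)) < \<infinity>"
    using le_less_trans by fastforce
qed

lemma norm_bound_in_stolz_angle:
  assumes "z \<in> stolz_angle x R"
  shows "norm (x - z) \<le> R * (1 - (norm z)\<^sup>2)"
proof -
  have z: "norm z < 1" "norm (x - z) < R * (1 - norm z)" using assms by (auto simp: stolz_angle_iff)
  then have "R * (1 - norm z) > 0" using norm_ge_zero le_less_trans by blast
  then have "R > 0" using z(1) by (simp add: zero_less_mult_iff)
  have "norm z * norm z \<le> norm z * 1" using z(1) by (intro mult_left_mono) auto
  then have "R * (1 - norm z) \<le> R * (1 - (norm z)\<^sup>2)"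
    using \<open>R > 0\<close> by (simp add: power2_eq_square)
  then show ?thesis using z by simp
qed

text \<open>For \<open>s = 1 - cnj x * z\<close>, positivity of \<open>Re (s\<^sup>2)\<close>
  confines \<open>s\<close> to the sector of half-angle pi/4 about the inner normal, so
  \<open>norm s < 2 * Re s\<close>. Close to \<open>x\<close> the curvature of the circle is
  harmless and \<open>1 - norm z > 3 / 4 * Re s\<close>; together these give aperture 8/3, hence 4.
  The square is used because the flow moves it with almost constant velocity near a pole.\<close>

lemma stolz_angle_of_Re_square_pos:
  fixes x z :: complex
  assumes x: "norm x = 1" and z: "norm z < 1" and d: "norm (x - z) < 1 / 4"
    and pos: "Re ((1 - cnj x * z)\<^sup>2) > 0"
  shows "z \<in> stolz_angle x 4"
proof -
  define s where "s = 1 - cnj x * z"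
  have ns: "norm s = norm (x - z)" unfolding s_def by (rule norm_one_minus_cnj_mult_unit[OF x])
  have nz: "norm (1 - s) = norm z" using x by (simp add: s_def norm_mult)
  have "Re (cnj x * z) < 1"
    using complex_Re_le_cmod[of "cnj x * z"] x z by (simp add: norm_mult)
  then have Re: "Re s > 0" by (simp add: s_def)
  have sq: "(Im s)\<^sup>2 < (Re s)\<^sup>2" using pos by (simp add: s_def[symmetric] power2_eq_square)
  have "(norm s)\<^sup>2 = (Re s)\<^sup>2 + (Im s)\<^sup>2" by (rule cmod_power2)
  then have s2: "(norm s)\<^sup>2 < 2 * (Re s)\<^sup>2" using sq by simp
  also have "\<dots> \<le> (2 * Re s)\<^sup>2" by (simp add: power2_eq_square)
  finally have "norm s < 2 * Re s" by (rule power2_less_imp_less) (use Re in auto)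
  have "Re s < 1 / 4" using complex_Re_le_cmod[of s] ns d by simp
  then have "Re s * Re s \<le> Re s * (1 / 4)" using Re by (intro mult_left_mono) auto
  have "(norm z)\<^sup>2 = (1 - Re s)\<^sup>2 + (Im s)\<^sup>2" using nz by (metis cmod_power2 minus_complex.sel one_complex.sel power2_minus diff_0)
  also have "\<dots> < 1 - 2 * Re s + 2 * (Re s)\<^sup>2" using sq by (simp add: power2_eq_square algebra_simps)
  also have "\<dots> \<le> 1 - 3 / 2 * Re s" using \<open>Re s * Re s \<le> Re s * (1 / 4)\<close> by (simp add: power2_eq_square)
  finally have "3 / 2 * Re s < (1 - norm z) * (1 + norm z)" by (simp add: power2_eq_square algebra_simps)
  also have "\<dots> \<le> (1 - norm z) * 2" using z by (intro mult_left_mono) auto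
  finally have "norm (x - z) < 4 * (1 - norm z)"
    using \<open>norm s < 2 * Re s\<close> ns z by simp
  then show ?thesis using z by (simp add: stolz_angle_iff)
qed

text \<open>A point \<open>z\<close> of the angle and the radial point \<open>w\<close> of the same
  modulus are at bounded hyperbolic distance. Schwarz-Pick therefore transfers the bound from the
  radius to the angle, with a larger constant.\<close>

lemma self_map_bounded_in_stolz_angle:
  assumes f: "f holomorphic_on ball 0 1" "f ` ball 0 1 \<subseteq> ball 0 1"
    and x: "norm x = 1" and \<rho>: "0 \<le> \<rho>" "\<rho> < 1"
    and rad: "eventually (\<lambda>r. norm (f (of_real r * x)) \<le> \<rho>) (at_left 1)" and R: "R > 1"
  obtains \<rho>' where "\<rho>' < 1" "eventually (\<lambda>z. norm (f z) \<le> \<rho>') (at x within stolz_angle x R)"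
proof -
  \<comment> \<open>Lower bound for \<open>1 - (norm (f z))\<^sup>2\<close>: the numerator bounds
    \<open>norm (1 - cnj (f w) * f z)\<close> from below, and \<open>R + 1\<close> is the bound for
    \<open>norm (1 - cnj w * z) / (1 - r\<^sup>2)\<close>.\<close>
  define e where "e = ((1 - \<rho>) / (R + 1))\<^sup>2"
  have e: "e > 0" using \<rho> R by (simp add: e_def)
  have fd: "norm (f u) < 1" if "norm u < 1" for u
    using f(2) that by (auto simp: image_subset_iff)
  have "((\<lambda>z. norm z) \<longlongrightarrow> norm x) (at x within stolz_angle x R)" by (intro tendsto_intros)
  then have "filterlim norm (at_left (1::real)) (at x within stolz_angle x R)"
    unfolding filterlim_at x using eventually_in_stolz_angle[of x R]
    by (auto elim!: eventually_mono simp: stolz_angle_iff)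
  then have "eventually (\<lambda>z. norm (f (of_real (norm z) * x)) \<le> \<rho>) (at x within stolz_angle x R)"
    using rad by (rule eventually_compose_filterlim[rotated])
  then have "eventually (\<lambda>z. norm (f z) \<le> sqrt (1 - e)) (at x within stolz_angle x R)"
    using eventually_in_stolz_angle[of x R]
  proof eventually_elim
    case (elim z)
    define r where "r = norm z"
    define w where "w = of_real r * x"
    have r: "0 \<le> r" "r < 1" "norm (x - z) < R * (1 - r)" using elim(2) by (auto simp: r_def stolz_angle_iff)
    have w: "norm w = r" using r x by (simp add: w_def norm_mult)
    have fw: "norm (f w) \<le> \<rho>" using elim(1) by (simp add: w_def r_def)
    have "1 - cnj w * z = (1 - cnj x * z) + of_real (1 - r) * (cnj x * z)"
      by (simp add: w_def algebra_simps)
    then have "norm (1 - cnj w * z) \<le> norm (1 - cnj x * z) + norm (of_real (1 - r) * (cnj x * z))"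
      by (metis norm_triangle_ineq)
    also have "norm (of_real (1 - r) * (cnj x * z)) = (1 - r) * r"
      using r x by (simp add: norm_mult r_def del: of_real_diff)
    also have "norm (1 - cnj x * z) = norm (x - z)" by (rule norm_one_minus_cnj_mult_unit[OF x])
    also have "norm (x - z) + (1 - r) * r \<le> R * (1 - r) + (1 - r) * 1"
      using r by (intro add_mono mult_left_mono) auto
    also have "\<dots> = (R + 1) * (1 - r)" by (simp add: algebra_simps)
    also have "\<dots> \<le> (R + 1) * (1 - r\<^sup>2)"
      using r R mult_left_mono[of r 1 r] by (intro mult_left_mono) (auto simp: power2_eq_square)
    finally have 1: "(norm (1 - cnj w * z))\<^sup>2 \<le> ((R + 1) * (1 - r\<^sup>2))\<^sup>2" by (intro power_mono) auto
    have "norm (cnj (f w) * f z) \<le> \<rho> * 1"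
      unfolding norm_mult using fw fd[of z] \<rho> r by (intro mult_mono) (auto simp: r_def)
    moreover have "1 - norm (cnj (f w) * f z) \<le> norm (1 - cnj (f w) * f z)"
      using norm_triangle_ineq2[of 1 "cnj (f w) * f z"] by simp
    ultimately have "1 - \<rho> \<le> norm (1 - cnj (f w) * f z)" by simp
    then have 2: "(1 - \<rho>)\<^sup>2 \<le> (norm (1 - cnj (f w) * f z))\<^sup>2" using \<rho> by (intro power_mono) auto
    have r2: "1 - r\<^sup>2 > 0" using r by (simp add: power_less_one_iff)
    have fz: "1 - (norm (f z))\<^sup>2 \<ge> 0" using fd[of z] r by (simp add: r_def power_le_one)
    have "(1 - r\<^sup>2)\<^sup>2 * (1 - \<rho>)\<^sup>2 \<le> (1 - r\<^sup>2)\<^sup>2 * (norm (1 - cnj (f w) * f z))\<^sup>2"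
      using 2 by (intro mult_left_mono) auto
    also have "\<dots> = (1 - (norm z)\<^sup>2) * (1 - (norm w)\<^sup>2) * (norm (1 - cnj (f w) * f z))\<^sup>2"
      by (simp add: w r_def power2_eq_square)
    also have "\<dots> \<le> (1 - (norm (f z))\<^sup>2) * (1 - (norm (f w))\<^sup>2) * (norm (1 - cnj w * z))\<^sup>2"
      using r w by (intro Schwarz_Pick f) (auto simp: r_def)
    also have "\<dots> \<le> (1 - (norm (f z))\<^sup>2) * 1 * ((R + 1) * (1 - r\<^sup>2))\<^sup>2"
      using 1 fz fd[of w] w r by (intro mult_mono) (auto simp: power_le_one)
    also have "\<dots> = (1 - r\<^sup>2)\<^sup>2 * ((1 - (norm (f z))\<^sup>2) * (R + 1)\<^sup>2)"
      by (simp add: power_mult_distrib)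
    finally have "(1 - \<rho>)\<^sup>2 \<le> (1 - (norm (f z))\<^sup>2) * (R + 1)\<^sup>2"
      using r2 by simp
    then have "e \<le> 1 - (norm (f z))\<^sup>2"
      using R by (simp add: e_def power_divide divide_le_eq)
    then show ?case by (intro real_le_rsqrt) simp
  qed
  moreover have "sqrt (1 - e) < 1" using e by simp
  ultimately show ?thesis by (rule that[rotated])
qed

text \<open>Cauchy's estimate for \<open>f w - L * (w - x)\<close> on a disc about \<open>z\<close>
  with radius proportional to the distance from \<open>x\<close>. Such discs stay in a Stolz angle
  of larger aperture, where the quotient is already close to \<open>L\<close>.\<close>

lemma angular_lim_deriv:
  assumes f: "f holomorphic_on ball 0 1" and x: "norm x = 1"
    and lim: "angular_lim (\<lambda>z. f z / (z - x)) x L"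
  shows "angular_lim f x 0" "angular_lim (deriv f) x L"
proof -
  show "angular_lim f x 0"
    unfolding angular_lim_def
  proof (intro allI impI)
    fix R :: real assume "R > 1"
    then have "((\<lambda>z. f z / (z - x) * (z - x)) \<longlongrightarrow> L * (x - x)) (at x within stolz_angle x R)"
      by (intro tendsto_intros angular_limD[OF lim])
    moreover have "eventually (\<lambda>z. f z / (z - x) * (z - x) = f z) (at x within stolz_angle x R)"
      by (auto simp: eventually_at_filter)
    ultimately show "(f \<longlongrightarrow> 0) (at x within stolz_angle x R)"
      using Lim_transform_eventually by fastforce
  qed
  show "angular_lim (deriv f) x L"
    unfolding angular_lim_def
  proof (intro allI impI tendstoI)
    fix R e :: real assume R: "R > 1" and e: "e > 0"
    \<comment> \<open>With \<open>s = D / (2 * R)\<close> the Cauchy bound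
      \<open>d * (2 * D) / s\<close> equals \<open>4 * R * d\<close>, that is
      \<open>e / 2\<close>.\<close>
    define d where "d = e / (8 * R)"
    have d: "d > 0" using e R by (simp add: d_def)
    have "eventually (\<lambda>z. dist (f z / (z - x)) L < d) (at x within stolz_angle x (4 * R))"
      using R d by (intro tendstoD angular_limD[OF lim]) auto
    then obtain \<delta> where \<delta>: "\<delta> > 0"
      "\<And>w. w \<in> stolz_angle x (4 * R) \<Longrightarrow> w \<noteq> x \<Longrightarrow> dist w x < \<delta> \<Longrightarrow> dist (f w / (w - x)) L < d"
      unfolding eventually_at by blast
    have main: "dist (deriv f z) L < e"
      if z: "z \<in> stolz_angle x R" "z \<noteq> x" "dist z x < \<delta> / 2" for z
    proof -
      define D where "D = norm (x - z)"
      define s where "s = D / (2 * R)"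
      have D: "D > 0" "D < \<delta> / 2" using z(2,3) by (auto simp: D_def dist_norm norm_minus_commute)
      have s: "s > 0" "s \<le> D" using D R by (auto simp: s_def divide_le_eq)
      have zR: "D < R * (1 - norm z)" "norm z < 1" using z(1) by (auto simp: stolz_angle_iff D_def)
      \<comment> \<open>Moving by at most \<open>s\<close> at most doubles the distance to
        \<open>x\<close> and at most halves the distance to the circle, whence the factor 4 in the
        aperture.\<close>
      have near: "w \<in> stolz_angle x (4 * R)" "norm (x - w) \<le> 2 * D" "norm w < 1" if w: "norm (z - w) \<le> s" for w
      proof -
        have "norm (x - w) \<le> norm (x - z) + norm (z - w)"
          by (metis dist_norm dist_triangle)
        then show a: "norm (x - w) \<le> 2 * D" using w s by (simp add: D_def)
        have "norm w \<le> norm z + norm (z - w)" by (metis norm_minus_commute norm_triangle_sub)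
        moreover have "s < (1 - norm z) / 2"
          using zR R by (simp add: s_def field_simps)
        ultimately have b: "1 - norm w > (1 - norm z) / 2" using w by (simp add: field_simps)
        then show "norm w < 1" using zR by simp
        have "2 * D < 2 * (R * (1 - norm z))" using zR by simp
        also have "\<dots> \<le> 4 * R * (1 - norm w)"
        proof -
          have "R * ((1 - norm z) / 2) \<le> R * (1 - norm w)" using b R by (intro mult_left_mono) auto
          then show ?thesis by simp
        qed
        finally show "w \<in> stolz_angle x (4 * R)" using a \<open>norm w < 1\<close> by (simp add: stolz_angle_iff)
      qed
      define g where "g w = f w - L * (w - x)" for w
      have sub: "cball z s \<subseteq> ball 0 1" using near(3) by (auto simp: dist_norm)
      have g: "g holomorphic_on ball 0 1" unfolding g_def by (intro holomorphic_intros f)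
      have "norm ((deriv ^^ 1) g z) \<le> fact 1 * (d * (2 * D)) / s ^ 1"
      proof (rule Cauchy_inequality)
        show "g holomorphic_on ball z s" using g by (rule holomorphic_on_subset) (use sub in auto)
        show "continuous_on (cball z s) g"
          using g sub holomorphic_on_imp_continuous_on continuous_on_subset by blast
        show "s > 0" by fact
        fix w assume w: "norm (z - w) = s"
        show "norm (g w) \<le> d * (2 * D)"
        proof (cases "w = x")
          case True
          then show ?thesis using near(3)[of x] w x by simp
        next
          case False
          then have "dist (f w / (w - x)) L < d"
            using near[of w] w D by (intro \<delta>) (auto simp: dist_norm norm_minus_commute)
          moreover have "g w = (f w / (w - x) - L) * (w - x)"
            using False by (simp add: g_def left_diff_distrib)
          ultimately have "norm (g w) \<le> d * norm (w - x)"
            by (simp add: norm_mult dist_norm mult_right_mono)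
          also have "\<dots> \<le> d * (2 * D)"
            using near(2)[of w] w d by (intro mult_left_mono) (auto simp: norm_minus_commute)
          finally show ?thesis .
        qed
      qed
      also have "fact 1 * (d * (2 * D)) / s ^ 1 = e / 2"
        using D R by (simp add: s_def d_def)
      finally have "norm (deriv g z) < e" using e by simp
      moreover have "deriv g z = deriv f z - L"
      proof -
        have "(f has_field_derivative deriv f z) (at z)"
          using zR by (intro holomorphic_derivI[OF f]) auto
        then have "(g has_field_derivative deriv f z - L) (at z)"
          unfolding g_def by (auto intro!: derivative_eq_intros)
        then show ?thesis by (rule DERIV_imp_deriv)
      qed
      ultimately show ?thesis by (simp add: dist_norm)
    qed
    then show "eventually (\<lambda>z. dist (deriv f z) L < e) (at x within stolz_angle x R)"
      unfolding eventually_at using \<delta>(1) by (intro exI[of _ "\<delta> / 2"]) auto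
  qed
qed

lemma radial_difference_bound:
  assumes f: "f holomorphic_on ball 0 1" and x: "norm x = 1" and rs: "0 \<le> r" "r \<le> s" "s < 1"
    and B: "\<And>u. r \<le> u \<Longrightarrow> u \<le> s \<Longrightarrow> norm (deriv f (of_real u * x)) \<le> B"
  shows "norm (f (of_real r * x) - f (of_real s * x)) \<le> B * (s - r)"
proof -
  have seg: "\<exists>u. r \<le> u \<and> u \<le> s \<and> w = of_real u * x"
    if w: "w \<in> closed_segment (of_real r * x) (of_real s * x)" for w
  proof -
    obtain a where a: "0 \<le> a" "a \<le> 1" "w = (1 - a) *\<^sub>R (of_real r * x) + a *\<^sub>R (of_real s * x)"
      using w unfolding in_segment by blast
    have "w = of_real (r + a * (s - r)) * x"
      by (simp add: a(3) scaleR_conv_of_real algebra_simps)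
    moreover have "0 \<le> a * (s - r)" "a * (s - r) \<le> 1 * (s - r)"
      using a rs by (simp, intro mult_right_mono, simp_all)
    ultimately show ?thesis by (intro exI[of _ "r + a * (s - r)"]) auto
  qed
  have "norm (f (of_real r * x) - f (of_real s * x)) \<le> B * norm (of_real r * x - of_real s * x)"
  proof (rule field_differentiable_bound[of "closed_segment (of_real r * x) (of_real s * x)" f "deriv f"])
    fix w assume w: "w \<in> closed_segment (of_real r * x) (of_real s * x)"
    then obtain u where u: "r \<le> u" "u \<le> s" "w = of_real u * x" using seg by blast
    show "norm (deriv f w) \<le> B" using B u by simp
    have "norm w < 1" using u rs x by (simp add: norm_mult)
    then show "(f has_field_derivative deriv f w) (at w within closed_segment (of_real r * x) (of_real s * x))"
      using holomorphic_derivI[OF f, of w] by (auto intro: has_field_derivative_at_within)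
  qed auto
  also have "of_real r * x - of_real s * x = of_real (r - s) * x" by (simp add: algebra_simps)
  also have "norm (of_real (r - s) * x) = s - r" using rs x by (simp add: norm_mult del: of_real_diff)
  finally show ?thesis .
qed

section \<open>The Julia-Wolff-Caratheodory limit in the right half-plane\<close>

text \<open>Let \<open>c\<close> be the largest multiple of the Poisson kernel at \<open>x\<close>
  that lies below \<open>Re q\<close>. Subtracting \<open>c\<close> times the Herglotz kernel leaves
  \<open>Q\<close> with \<open>Re Q \<ge> 0\<close> and with infimum 0 for \<open>Re Q / P\<close>.
  Comparing \<open>z\<close> with a point \<open>w\<close> where this quotient is nearly 0 shows
  that \<open>Q z * (x - z)\<close> tends to 0; the subtracted kernel contributes
  \<open>2 * c * x\<close>.\<close>

lemma Julia_angular_limit: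
  fixes q :: "complex \<Rightarrow> complex"
  assumes q: "q holomorphic_on ball 0 1" "\<And>z. norm z < 1 \<Longrightarrow> Re (q z) \<ge> 0"
    and x: "norm x = 1"
  obtains c :: real where "c \<ge> 0" "angular_lim (\<lambda>z. q z * (x - z)) x (2 * of_real c * x)"
proof -
  \<comment> \<open>\<open>P\<close> is the Poisson kernel with pole at \<open>x\<close>, and
    \<open>k\<close> is the Herglotz kernel, whose real part is \<open>P\<close>.\<close>
  define P where "P z = (1 - (norm z)\<^sup>2) / (norm (x - z))\<^sup>2" for z
  define k where "k z = (x + z) / (x - z)" for z
  have nx: "x - z \<noteq> 0" if "norm z < 1" for z using that x by auto
  have P: "P z > 0" if "norm z < 1" for z
    using that nx[OF that] by (auto simp: P_def power_less_one_iff intro!: divide_pos_pos)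
  have k: "Re (k z) = P z" if "norm z < 1" for z
  proof -
    have "Re ((x + z) * cnj (x - z)) = (norm x)\<^sup>2 - (norm z)\<^sup>2"
      unfolding cmod_power2 by (simp add: power2_eq_square algebra_simps)
    moreover have "k z = (x + z) * cnj (x - z) / of_real ((norm (x - z))\<^sup>2)"
      using nx[OF that] by (subst complex_norm_square) (simp add: k_def del: complex_cnj_diff)
    ultimately show ?thesis
      by (simp add: P_def x del: complex_cnj_diff of_real_power)
  qed
  define c where "c = (INF z\<in>ball 0 1. Re (q z) / P z)"
  have bdd: "bdd_below ((\<lambda>z. Re (q z) / P z) ` ball 0 1)"
    using q(2) P by (intro bdd_belowI[of _ 0]) (auto intro!: divide_nonneg_pos)
  have c0: "c \<ge> 0"
    unfolding c_def using q(2) P by (intro cINF_greatest) (auto intro!: divide_nonneg_pos)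
  have cle: "c * P z \<le> Re (q z)" if "norm z < 1" for z
  proof -
    have "c \<le> Re (q z) / P z" unfolding c_def using that by (intro cINF_lower bdd) auto
    then show ?thesis using P[OF that] by (simp add: pos_le_divide_eq)
  qed
  define Q where "Q z = q z - of_real c * k z" for z
  have Q0: "Re (Q z) \<ge> 0" if "norm z < 1" for z
    using cle[OF that] k[OF that] by (simp add: Q_def)
  have holQ: "Q holomorphic_on ball 0 1"
    unfolding Q_def k_def using nx by (intro holomorphic_intros q) auto
  have main: "((\<lambda>z. Q z * (x - z)) \<longlongrightarrow> 0) (at x within stolz_angle x R)" if R: "R > 1" for R
  proof (rule tendstoI)
    fix e :: real assume e: "e > 0"
    define d where "d = e / (8 * R)"
    have d: "d > 0" using e R by (simp add: d_def)
    have "(INF z\<in>ball 0 1. Re (q z) / P z) < c + d" using d by (simp add: c_def)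
    then obtain w where w: "norm w < 1" "Re (q w) / P w < c + d"
      by (subst (asm) cINF_less_iff) (auto intro: bdd)
    then have Qw: "Re (Q w) < d * P w"
      using P[OF w(1)] k[OF w(1)] by (simp add: Q_def divide_less_eq algebra_simps)
    \<comment> \<open>Adding \<open>m\<close> to \<open>Q\<close> makes its real part strictly
      positive, as \<open>Schwarz_Pick_half_plane\<close> demands. Half of the available gap is
      taken so that the inequality at \<open>w\<close> stays strict.\<close>
    define m where "m = (d * P w - Re (Q w)) / 2"
    have m: "m > 0" using Qw by (simp add: m_def)
    have mw: "Re (Q w) + m < d * P w"
    proof -
      have "a + (b - a) / 2 < b" if "a < b" for a b :: real using that by (simp add: field_simps)
      then show ?thesis unfolding m_def using Qw by blast
    qed
    define B where "B = Re (Q w) + m"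
    define C where "C = norm (cnj (Q w + of_real m)) + m"
    have B: "B > 0" using m Q0[OF w(1)] by (auto simp: B_def)
    \<comment> \<open>The factor \<open>1 - (norm z)\<^sup>2\<close> lost in the half-plane
      inequality is regained from \<open>norm (x - z) \<le> R * (1 - (norm z)\<^sup>2)\<close>. The
      resulting majorant is continuous up to \<open>x\<close>.\<close>
    have bound: "norm (Q z * (x - z)) \<le> 4 * R * B / (1 - (norm w)\<^sup>2) * (norm (1 - cnj w * z))\<^sup>2 + norm (x - z) * C"
      if z: "z \<in> stolz_angle x R" for z
    proof -
      have z1: "norm z < 1" using z by (simp add: stolz_angle_iff)
      have pz: "1 - (norm z)\<^sup>2 > 0" "1 - (norm w)\<^sup>2 > 0"
        using z1 w by (simp_all add: power_less_one_iff)
      have "norm ((Q z + of_real m) + cnj (Q w + of_real m)) * ((1 - (norm z)\<^sup>2) * (1 - (norm w)\<^sup>2))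
          \<le> 4 * Re (Q w + of_real m) * (norm (1 - cnj w * z))\<^sup>2"
        using Q0 m z1 w(1)
        by (intro Schwarz_Pick_half_plane holomorphic_intros holQ) (auto simp: add_nonneg_pos)
      then have "norm ((Q z + of_real m) + cnj (Q w + of_real m))
          \<le> 4 * B * (norm (1 - cnj w * z))\<^sup>2 / ((1 - (norm z)\<^sup>2) * (1 - (norm w)\<^sup>2))"
        using pz by (subst pos_le_divide_eq) (auto simp: B_def)
      moreover have "norm (Q z) \<le> norm ((Q z + of_real m) + cnj (Q w + of_real m)) + C"
      proof -
        have "norm (Q z) = norm (((Q z + of_real m) + cnj (Q w + of_real m)) - (cnj (Q w + of_real m) + of_real m))"
          by simp
        also have "\<dots> \<le> norm ((Q z + of_real m) + cnj (Q w + of_real m)) + norm (cnj (Q w + of_real m) + of_real m)"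
          by (rule norm_triangle_ineq4)
        also have "norm (cnj (Q w + of_real m) + of_real m) \<le> C"
          unfolding C_def using m by (intro order_trans[OF norm_triangle_ineq]) auto
        finally show ?thesis by simp
      qed
      ultimately have "norm (Q z) * norm (x - z) \<le>
           (4 * B * (norm (1 - cnj w * z))\<^sup>2 / ((1 - (norm z)\<^sup>2) * (1 - (norm w)\<^sup>2)) + C) * norm (x - z)"
        by (intro mult_right_mono) auto
      also have "\<dots> = 4 * B * (norm (1 - cnj w * z))\<^sup>2 / ((1 - (norm z)\<^sup>2) * (1 - (norm w)\<^sup>2)) * norm (x - z) + norm (x - z) * C"
        by (simp add: algebra_simps)
      also have "4 * B * (norm (1 - cnj w * z))\<^sup>2 / ((1 - (norm z)\<^sup>2) * (1 - (norm w)\<^sup>2)) * norm (x - z)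
          \<le> 4 * B * (norm (1 - cnj w * z))\<^sup>2 / ((1 - (norm z)\<^sup>2) * (1 - (norm w)\<^sup>2)) * (R * (1 - (norm z)\<^sup>2))"
        using norm_bound_in_stolz_angle[OF z] pz B by (intro mult_left_mono divide_nonneg_pos mult_pos_pos) auto
      also have "\<dots> = 4 * R * B / (1 - (norm w)\<^sup>2) * (norm (1 - cnj w * z))\<^sup>2"
      proof -
        have "4 * B * n / (p * p') * (R * p) = 4 * R * B / p' * n" if "p > 0" for p p' n :: real
          using that by simp
        then show ?thesis using pz(1) by blast
      qed
      finally show ?thesis by (simp add: norm_mult)
    qed
    have "((\<lambda>z. 4 * R * B / (1 - (norm w)\<^sup>2) * (norm (1 - cnj w * z))\<^sup>2 + norm (x - z) * C)
         \<longlongrightarrow> 4 * R * B / (1 - (norm w)\<^sup>2) * (norm (1 - cnj w * x))\<^sup>2 + norm (x - x) * C) (at x within stolz_angle x R)"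
      by (intro tendsto_intros)
    \<comment> \<open>At \<open>z = x\<close> the first term becomes \<open>4 * R * B / P w\<close>,
      which is below \<open>4 * R * d = e / 2\<close>, and the term with \<open>C\<close>
      vanishes.\<close>
    moreover have "4 * R * B / (1 - (norm w)\<^sup>2) * (norm (1 - cnj w * x))\<^sup>2 + norm (x - x) * C < e"
    proof -
      have "norm (1 - cnj w * x) = norm (x - w)"
        using norm_one_minus_cnj_mult_sq[of w x] x by (simp add: power2_eq_iff_nonneg)
      moreover have "1 - (norm w)\<^sup>2 = P w * (norm (x - w))\<^sup>2" "P w > 0" "norm (x - w) \<noteq> 0"
        using nx[OF w(1)] P[OF w(1)] by (auto simp: P_def)
      ultimately have "4 * R * B / (1 - (norm w)\<^sup>2) * (norm (1 - cnj w * x))\<^sup>2 = 4 * R * (B / P w)"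
        by simp
      also have "\<dots> < 4 * R * d"
        using mw \<open>P w > 0\<close> R by (simp add: B_def divide_less_eq)
      also have "\<dots> < e" using e R by (simp add: d_def)
      finally show ?thesis by simp
    qed
    ultimately have "eventually (\<lambda>z. 4 * R * B / (1 - (norm w)\<^sup>2) * (norm (1 - cnj w * z))\<^sup>2 + norm (x - z) * C < e)
        (at x within stolz_angle x R)"
      by (rule order_tendstoD(2))
    then show "eventually (\<lambda>z. dist (Q z * (x - z)) 0 < e) (at x within stolz_angle x R)"
      using eventually_in_stolz_angle
      by eventually_elim (use bound in \<open>force intro: le_less_trans\<close>)
  qed
  have "angular_lim (\<lambda>z. q z * (x - z)) x (2 * of_real c * x)"
    unfolding angular_lim_def
  proof (intro allI impI)
    fix R :: real assume R: "R > 1"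
    have "((\<lambda>z. Q z * (x - z) + of_real c * (x + z)) \<longlongrightarrow> 0 + of_real c * (x + x)) (at x within stolz_angle x R)"
      by (intro tendsto_intros main R)
    moreover have "eventually (\<lambda>z. Q z * (x - z) + of_real c * (x + z) = q z * (x - z)) (at x within stolz_angle x R)"
      using eventually_in_stolz_angle
    proof eventually_elim
      case (elim z)
      then have "x - z \<noteq> 0" using nx by (auto simp: stolz_angle_iff)
      then have "k z * (x - z) = x + z" by (simp add: k_def)
      then show ?case unfolding Q_def left_diff_distrib by (simp add: mult.assoc)
    qed
    ultimately have "((\<lambda>z. q z * (x - z)) \<longlongrightarrow> 0 + of_real c * (x + x)) (at x within stolz_angle x R)"
      by (rule Lim_transform_eventually)
    then show "((\<lambda>z. q z * (x - z)) \<longlongrightarrow> 2 * of_real c * x) (at x within stolz_angle x R)"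
      by (simp add: mult_ac)
  qed
  with c0 show ?thesis using that by blast
qed

subsection \<open>Semigroups and their generators\<close>

locale semigroup_with_generator =
  fixes \<phi> :: "real \<Rightarrow> complex \<Rightarrow> complex" and G :: "complex \<Rightarrow> complex"
  assumes semigroup: "holomorphic_semigroup \<phi>"
    and generator: "infinitesimal_generator_of \<phi> G"
begin

lemma holomorphic_phi: "t \<ge> 0 \<Longrightarrow> \<phi> t holomorphic_on ball 0 1"
  and phi_image: "t \<ge> 0 \<Longrightarrow> \<phi> t ` ball 0 1 \<subseteq> ball 0 1"
  and phi_0: "norm z < 1 \<Longrightarrow> \<phi> 0 z = z"
  and phi_add: "t \<ge> 0 \<Longrightarrow> s \<ge> 0 \<Longrightarrow> norm z < 1 \<Longrightarrow> \<phi> (t + s) z = \<phi> t (\<phi> s z)"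
  using semigroup by (auto simp: holomorphic_semigroup_def)

lemma norm_phi: "t \<ge> 0 \<Longrightarrow> norm z < 1 \<Longrightarrow> norm (\<phi> t z) < 1"
  using phi_image by (force simp: image_subset_iff)

lemma holomorphic_G: "G holomorphic_on ball 0 1"
  and flow: "t \<ge> 0 \<Longrightarrow> norm z < 1 \<Longrightarrow>
      ((\<lambda>s. \<phi> s z) has_vector_derivative G (\<phi> t z)) (at t within {0..})"
  using generator by (auto simp: infinitesimal_generator_of_def)

lemma flow_at: "t > 0 \<Longrightarrow> norm z < 1 \<Longrightarrow> ((\<lambda>s. \<phi> s z) has_vector_derivative G (\<phi> t z)) (at t)"
  using flow[of t z] at_within_interior[of t "{0..}"] by simp

lemma continuous_on_flow: "norm z < 1 \<Longrightarrow> continuous_on {0..} (\<lambda>s. \<phi> s z)"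
  unfolding continuous_on_eq_continuous_within
  using flow by (auto intro: has_vector_derivative_continuous)

lemma phi_has_field_derivative:
  assumes "t \<ge> 0" "norm z < 1"
  shows "(\<phi> t has_field_derivative deriv (\<phi> t) z) (at z)"
  using holomorphic_derivI[OF holomorphic_phi[OF assms(1)], of z] assms by simp

text \<open>Both sides are the right derivative at \<open>s = 0\<close> of
  \<open>\<phi> (t + s) z = \<phi> t (\<phi> s z)\<close>, computed once by the chain rule in the
  inner orbit and once by a shift of time.\<close>

lemma deriv_phi_mult_generator:
  assumes t: "t \<ge> 0" and z: "norm z < 1"
  shows "deriv (\<phi> t) z * G z = G (\<phi> t z)"
proof -
  have 1: "((\<phi> t \<circ> (\<lambda>s. \<phi> s z)) has_vector_derivative G z * deriv (\<phi> t) z) (at 0 within {0..})"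
    using flow[of 0 z] phi_has_field_derivative[OF t z] z
    by (intro field_vector_diff_chain_within) (auto simp: phi_0 intro: has_field_derivative_at_within)
  have "((\<lambda>s. \<phi> s z) has_vector_derivative G (\<phi> t z)) (at (t + 0) within (+) t ` {0..})"
    using has_vector_derivative_within_subset[OF flow[OF t z], of "(+) t ` {0..}"] t by auto
  then have "(((\<lambda>s. \<phi> s z) \<circ> (+) t) has_vector_derivative 1 *\<^sub>R G (\<phi> t z)) (at 0 within {0..})"
    by (intro vector_diff_chain_within) (auto intro!: derivative_eq_intros)
  then have "((\<phi> t \<circ> (\<lambda>s. \<phi> s z)) has_vector_derivative 1 *\<^sub>R G (\<phi> t z)) (at 0 within {0..})"
    by (rule has_vector_derivative_transform[rotated 2]) (use t z phi_add in auto)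
  then have "((\<phi> t \<circ> (\<lambda>s. \<phi> s z)) has_vector_derivative G (\<phi> t z)) (at 0 within {0..})"
    by simp
  with 1 have "G z * deriv (\<phi> t) z = G (\<phi> t z)"
    by (rule vector_derivative_unique_within[rotated]) (simp add: at_within_Ici_at_right)
  then show ?thesis by (simp add: mult.commute)
qed

text \<open>Backward uniqueness for the flow. Both orbits up to time \<open>t\<close> lie in one
  compact disc, on which \<open>G\<close> has a Lipschitz constant \<open>L\<close>. The squared
  distance of the orbits times \<open>exp (2 * L * s)\<close> is then nondecreasing, so if it is 0
  at time \<open>t\<close>, it was 0 at the start.\<close>

lemma inj_on_phi:
  assumes t: "t \<ge> 0"
  shows "inj_on (\<phi> t) (ball 0 1)"
proof (rule inj_onI)
  fix z w assume "z \<in> ball 0 1" "w \<in> ball 0 1" and eq: "\<phi> t z = \<phi> t w"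
  then have zw: "norm z < 1" "norm w < 1" by auto
  have co: "continuous_on {0..t} (\<lambda>s. \<phi> s u)" if "norm u < 1" for u
    using continuous_on_flow[OF that] by (rule continuous_on_subset) auto
  have "compact ((\<lambda>s. \<phi> s z) ` {0..t} \<union> (\<lambda>s. \<phi> s w) ` {0..t})"
    by (intro compact_Un compact_continuous_image co zw compact_Icc)
  moreover have "(\<lambda>s. \<phi> s z) ` {0..t} \<union> (\<lambda>s. \<phi> s w) ` {0..t} \<subseteq> ball 0 1"
    using norm_phi zw by auto
  ultimately obtain r where r1: "r < 1"
      and "(\<lambda>s. \<phi> s z) ` {0..t} \<union> (\<lambda>s. \<phi> s w) ` {0..t} \<subseteq> cball 0 r"
    by (rule compact_subset_unit_ball)
  then have r: "\<phi> s z \<in> cball 0 r" "\<phi> s w \<in> cball 0 r" if "s \<in> {0..t}" for s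
    using that by (auto simp only: image_subset_iff Un_subset_iff)
  have sub: "cball 0 r \<subseteq> ball (0::complex) 1" using r1 by auto
  have "compact (deriv G ` cball 0 r)"
    using sub by (intro compact_continuous_image holomorphic_on_imp_continuous_on
        holomorphic_on_subset[OF holomorphic_deriv[OF holomorphic_G]]) auto
  then obtain L where L: "\<And>u. u \<in> cball 0 r \<Longrightarrow> norm (deriv G u) \<le> L"
    by (meson bounded_iff compact_imp_bounded image_eqI)
  have lip: "norm (G a - G b) \<le> L * norm (a - b)" if "a \<in> cball 0 r" "b \<in> cball 0 r" for a b
  proof (rule field_differentiable_bound[of "cball 0 r" G "deriv G"])
    show "(G has_field_derivative deriv G u) (at u within cball 0 r)" if "u \<in> cball 0 r" for u
      using holomorphic_derivI[OF holomorphic_G, of u] sub that by (auto intro: has_field_derivative_at_within)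
  qed (use that L in auto)
  define f where "f s = \<phi> s z - \<phi> s w" for s
  define g where "g s = G (\<phi> s z) - G (\<phi> s w)" for s
  define N where "N s = (f s \<bullet> f s) * exp (2 * L * s)" for s
  have cN: "continuous_on {0..t} N"
    unfolding N_def f_def by (intro continuous_intros co zw)
  have dN: "(N has_real_derivative (2 * (f s \<bullet> g s) + 2 * L * (f s \<bullet> f s)) * exp (2 * L * s)) (at s)" if "0 < s" for s
  proof -
    have "(f has_vector_derivative g s) (at s)"
      unfolding f_def g_def by (intro derivative_intros flow_at that zw)
    from bounded_bilinear.has_vector_derivative[OF bounded_bilinear_inner this this]
    have "((\<lambda>s. f s \<bullet> f s) has_real_derivative 2 * (f s \<bullet> g s)) (at s)"
      by (simp add: has_real_derivative_iff_has_vector_derivative inner_commute)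
    then show ?thesis unfolding N_def
      by (auto intro!: derivative_eq_intros simp: algebra_simps)
  qed
  have nn: "(2 * (f s \<bullet> g s) + 2 * L * (f s \<bullet> f s)) * exp (2 * L * s) \<ge> 0" if "0 < s" "s < t" for s
  proof -
    have "norm (g s) \<le> L * norm (f s)" unfolding f_def g_def using that by (intro lip r) auto
    then have "norm (f s) * norm (g s) \<le> norm (f s) * (L * norm (f s))" by (intro mult_left_mono) auto
    moreover have "\<bar>f s \<bullet> g s\<bar> \<le> norm (f s) * norm (g s)" by (rule Cauchy_Schwarz_ineq2)
    ultimately have "- (f s \<bullet> g s) \<le> L * (f s \<bullet> f s)"
      by (simp add: dot_square_norm power2_eq_square algebra_simps)
    then show ?thesis by simp
  qed
  have "N 0 \<le> N t"
  proof (rule DERIV_nonneg_imp_increasing_open[OF t _ cN])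
    show "\<exists>y. (N has_real_derivative y) (at s) \<and> 0 \<le> y" if "0 < s" "s < t" for s
      using dN nn that by blast
  qed
  also have "N t = 0" using eq by (simp add: N_def f_def)
  finally have "f 0 \<bullet> f 0 \<le> 0" by (simp add: N_def)
  then have "f 0 = 0" by (metis inner_ge_zero inner_eq_zero_iff order_antisym)
  then show "z = w" using zw by (simp add: f_def phi_0)
qed

section \<open>The angular limit of the generator\<close>

text \<open>Schwarz-Pick with base point 0 makes \<open>N t\<close> nonnegative, and
  \<open>N 0 = 0\<close>. Hence its right derivative \<open>D\<close> at 0 is nonnegative, and
  \<open>D\<close> is twice the real part in question.\<close>

lemma Re_generator:
  assumes z: "norm z < 1"
  shows "Re (cnj z * (G 0 - cnj (G 0) * z\<^sup>2 - G z)) \<ge> 0"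
proof -
  define a where "a = G 0"
  define u where "u t = 1 - cnj (\<phi> t 0) * \<phi> t z" for t
  define v where "v t = \<phi> t z - \<phi> t 0" for t
  define N where "N t = (norm z)\<^sup>2 * (u t \<bullet> u t) - v t \<bullet> v t" for t
  have N: "N t \<ge> 0" if t: "t \<ge> 0" for t
  proof -
    have 1: "norm (\<phi> t z) < 1" "norm (\<phi> t 0) < 1" using norm_phi t z by auto
    then have nz: "u t \<noteq> 0" unfolding u_def by (intro one_minus_cnj_mult_nonzero) auto
    have "norm (v t) / norm (u t) \<le> norm z"
      using Schwarz_Pick_Moebius[OF holomorphic_phi[OF t] phi_image[OF t] z, of 0]
      by (simp add: Moebius_function_simple norm_divide u_def v_def)
    then have "norm (v t) \<le> norm z * norm (u t)" using nz by (simp add: divide_le_eq)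
    then have "(norm (v t))\<^sup>2 \<le> (norm z * norm (u t))\<^sup>2" by (intro power_mono) auto
    then show ?thesis by (simp add: N_def dot_square_norm power_mult_distrib)
  qed
  have d0: "((\<lambda>s. \<phi> s 0) has_vector_derivative a) (at 0 within {0..})"
    and dz: "((\<lambda>s. \<phi> s z) has_vector_derivative G z) (at 0 within {0..})"
    using flow[of 0 0] flow[of 0 z] z by (auto simp: phi_0 a_def)
  have "((\<lambda>s. cnj (\<phi> s 0)) has_vector_derivative cnj a) (at 0 within {0..})"
    by (intro has_vector_derivative_cnj d0)
  from has_vector_derivative_mult[OF this dz]
  have prod: "((\<lambda>s. cnj (\<phi> s 0) * \<phi> s z) has_vector_derivative cnj a * z) (at 0 within {0..})"
    by (simp add: phi_0 z)
  then have du: "(u has_vector_derivative - (cnj a * z)) (at 0 within {0..})"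
    unfolding u_def using has_vector_derivative_diff[OF has_vector_derivative_const prod, of 1] by simp
  have dv: "(v has_vector_derivative G z - a) (at 0 within {0..})"
    unfolding v_def by (intro derivative_intros d0 dz)
  have uv0: "u 0 = 1" "v 0 = z" by (auto simp: u_def v_def phi_0 z)
  define D where "D = (norm z)\<^sup>2 * (2 * (1 \<bullet> - (cnj a * z))) - 2 * (z \<bullet> (G z - a))"
  have u2: "((\<lambda>s. u s \<bullet> u s) has_vector_derivative 2 * (1 \<bullet> - (cnj a * z))) (at 0 within {0..})"
    using bounded_bilinear.has_vector_derivative[OF bounded_bilinear_inner du du] by (simp add: uv0 inner_commute)
  have v2: "((\<lambda>s. v s \<bullet> v s) has_vector_derivative 2 * (z \<bullet> (G z - a))) (at 0 within {0..})"
    using bounded_bilinear.has_vector_derivative[OF bounded_bilinear_inner dv dv] by (simp add: uv0 inner_commute)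
  have "(N has_real_derivative D) (at 0 within {0..})"
    unfolding N_def D_def using u2 v2
    by (auto intro!: derivative_eq_intros simp flip: has_real_derivative_iff_has_vector_derivative)
  then have lim: "((\<lambda>y. (N y - N 0) / (y - 0)) \<longlongrightarrow> D) (at_right 0)"
    by (simp add: has_field_derivative_iff at_within_Ici_at_right)
  have "N 0 = 0" by (simp add: N_def uv0 dot_square_norm)
  then have "eventually (\<lambda>y. 0 \<le> (N y - N 0) / (y - 0)) (at_right 0)"
    by (intro eventually_mono[OF eventually_at_right_less[of 0]]) (simp add: N)
  then have "D \<ge> 0" by (rule tendsto_lowerbound[OF lim]) simp
  moreover have "D = 2 * Re (cnj z * (a - cnj a * z\<^sup>2 - G z))"
    unfolding D_def inner_complex_def cmod_power2 by (simp add: power2_eq_square algebra_simps)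
  ultimately show ?thesis by (simp add: a_def)
qed

text \<open>\<open>N\<close> vanishes at 0, so \<open>N z = z * q z\<close>, and
  \<open>Re_generator\<close> gives \<open>Re q \<ge> 0\<close> off 0, hence everywhere by
  continuity. In \<open>G z * (z - x)\<close> the polynomial part tends to 0, and
  \<open>z * (q z * (x - z))\<close> has the limit supplied by
  \<open>Julia_angular_limit\<close>.\<close>

lemma angular_lim_generator:
  assumes x: "norm x = 1"
  obtains k :: real where "k \<ge> 0" "angular_lim (\<lambda>z. G z * (z - x)) x (of_real k * x\<^sup>2)"
proof -
  define N where "N z = G 0 - cnj (G 0) * z\<^sup>2 - G z" for z
  define q where "q z = (if z = 0 then deriv N 0 else (N z - N 0) / (z - 0))" for z
  have hN: "N holomorphic_on ball 0 1"
    unfolding N_def by (intro holomorphic_intros holomorphic_G)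
  have hq: "q holomorphic_on ball 0 1"
    unfolding q_def by (rule pole_lemma[OF hN]) (simp add: interior_open)
  have N0: "N 0 = 0" by (simp add: N_def)
  have Nq: "N z = z * q z" for z by (simp add: q_def N0)
  have Re1: "Re (q z) \<ge> 0" if z: "norm z < 1" "z \<noteq> 0" for z
  proof -
    have "Re (cnj z * (z * q z)) \<ge> 0"
      using Re_generator[OF z(1)] unfolding N_def[symmetric] Nq[of z, symmetric] .
    moreover have "cnj z * (z * q z) = of_real ((norm z)\<^sup>2) * q z"
      by (subst complex_norm_square) simp
    ultimately have "(norm z)\<^sup>2 * Re (q z) \<ge> 0" by (simp del: of_real_power)
    then show ?thesis using z by (simp add: zero_le_mult_iff)
  qed
  have Re: "Re (q z) \<ge> 0" if z: "norm z < 1" for z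
  proof (cases "z = 0")
    case True
    have "isCont q 0"
      using holomorphic_on_imp_continuous_on[OF hq] by (simp add: continuous_on_eq_continuous_at)
    then have "((\<lambda>z. Re (q z)) \<longlongrightarrow> Re (q 0)) (at 0)"
      by (intro tendsto_intros) (simp add: isCont_def)
    moreover have "eventually (\<lambda>z. 0 \<le> Re (q z)) (at 0)"
      unfolding eventually_at using Re1 by (intro exI[of _ 1]) (auto simp: dist_norm)
    ultimately have "Re (q 0) \<ge> 0" by (intro tendsto_lowerbound) auto
    then show ?thesis using True by simp
  qed (use Re1 z in auto)
  obtain c where c: "c \<ge> 0" "angular_lim (\<lambda>z. q z * (x - z)) x (2 * of_real c * x)"
    using Julia_angular_limit[OF hq Re x] by blast
  have "angular_lim (\<lambda>z. G z * (z - x)) x (of_real (2 * c) * x\<^sup>2)"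
    unfolding angular_lim_def
  proof (intro allI impI)
    fix R :: real assume "R > 1"
    then have "((\<lambda>z. (G 0 - cnj (G 0) * z\<^sup>2) * (z - x) + z * (q z * (x - z))) \<longlongrightarrow>
        (G 0 - cnj (G 0) * x\<^sup>2) * (x - x) + x * (2 * of_real c * x)) (at x within stolz_angle x R)"
      by (intro tendsto_intros angular_limD[OF c(2)])
    moreover have "(G 0 - cnj (G 0) * z\<^sup>2) * (z - x) + z * (q z * (x - z)) = G z * (z - x)" for z
      using Nq[of z] by (simp add: N_def) algebra
    ultimately show "((\<lambda>z. G z * (z - x)) \<longlongrightarrow> of_real (2 * c) * x\<^sup>2) (at x within stolz_angle x R)"
      by (simp only:) (simp add: power2_eq_square mult_ac)
  qed
  then show ?thesis using c(1) that[of "2 * c"] by simp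
qed

text \<open>Near a pole the square \<open>\<psi> = (1 - cnj x * \<phi>)\<^sup>2\<close> has almost constant velocity \<open>2 * k > 0\<close>,
  so a trajectory issuing from the radius keeps \<open>Re \<psi> > 0\<close>, that is, it stays in a Stolz angle
  while it moves away from \<open>x\<close>.\<close>

lemma radial_orbits_enter_compact:
  assumes x: "norm x = 1" and k: "k > 0"
    and lim: "angular_lim (\<lambda>z. G z * (z - x)) x (of_real k * x\<^sup>2)" and t: "t > 0"
  obtains \<rho> where "0 \<le> \<rho>" "\<rho> < 1" "eventually (\<lambda>r. norm (\<phi> t (of_real r * x)) \<le> \<rho>) (at_left 1)"
proof -
  have xx: "cnj x * x = 1" using x by (simp add: complex_norm_square[symmetric] mult.commute)
  have "eventually (\<lambda>z. dist (G z * (z - x)) (of_real k * x\<^sup>2) < k / 2) (at x within stolz_angle x 4)"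
    using tendstoD[OF angular_limD[OF lim, of 4], of "k / 2"] k by simp
  then obtain d0 where d0: "d0 > 0"
      "\<And>z. z \<in> stolz_angle x 4 \<Longrightarrow> z \<noteq> x \<Longrightarrow> dist z x < d0 \<Longrightarrow> dist (G z * (z - x)) (of_real k * x\<^sup>2) < k / 2"
    unfolding eventually_at by blast
  define d where "d = min d0 (1 / 4)"
  have d: "d > 0" "d \<le> d0" "d \<le> 1 / 4" using d0 by (auto simp: d_def)
  \<comment> \<open>\<open>V (\<phi> s z)\<close> is the velocity of
    \<open>(1 - cnj x * \<phi> s z)\<^sup>2\<close>, rewritten by \<open>cnj x * x = 1\<close>. It
    tends to \<open>2 * k\<close> in the angle because
    \<open>(cnj x)\<^sup>2 * x\<^sup>2 = 1\<close>.\<close>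
  define V where "V z = 2 * (cnj x)\<^sup>2 * (G z * (z - x))" for z
  \<comment> \<open>The first condition on the square keeps the orbit in the angle of aperture 4,
    the second keeps it within \<open>d\<close> of \<open>x\<close>; there \<open>V\<close> differs
    from \<open>2 * k\<close> by at most \<open>k\<close>.\<close>
  define \<Omega> where "\<Omega> = {w::complex. Re w > 0 \<and> norm w < d\<^sup>2}"
  have in_stolz: "z \<in> stolz_angle x 4" "norm (x - z) < d"
    if z: "norm z < 1" "(1 - cnj x * z)\<^sup>2 \<in> \<Omega>" for z
  proof -
    note n = norm_one_minus_cnj_mult_unit[OF x, of z]
    have "(norm (x - z))\<^sup>2 < d\<^sup>2" using z(2) by (simp add: \<Omega>_def norm_power n)
    then show *: "norm (x - z) < d" by (rule power2_less_imp_less) (use d in auto)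
    show "z \<in> stolz_angle x 4"
      by (rule stolz_angle_of_Re_square_pos) (use x z * d in \<open>auto simp: \<Omega>_def\<close>)
  qed
  have V: "norm (V z - of_real (2 * k)) \<le> k"
    if z: "norm z < 1" "(1 - cnj x * z)\<^sup>2 \<in> \<Omega>" for z
  proof -
    have "norm (G z * (z - x) - of_real k * x\<^sup>2) < k / 2"
      using d0(2)[of z] in_stolz[OF z] d z(1) x by (force simp: dist_norm norm_minus_commute)
    moreover have "V z - of_real (2 * k) = 2 * (cnj x)\<^sup>2 * (G z * (z - x) - of_real k * x\<^sup>2)"
    proof -
      have "(cnj x)\<^sup>2 * x\<^sup>2 = 1" using xx by (metis power_mult_distrib power_one)
      then show ?thesis by (simp add: V_def algebra_simps)
    qed
    ultimately show ?thesis using x by (simp add: norm_mult norm_power)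
  qed
  \<comment> \<open>The speed in \<Omega> is at most \<open>3 * k\<close>, so a start below
    \<open>d\<^sup>2 / 2\<close> does not reach modulus \<open>d\<^sup>2\<close> by time
    \<open>T\<close>.\<close>
  define T where "T = min t (d\<^sup>2 / (6 * k))"
  have T: "0 < T" "T \<le> t" "3 * k * T \<le> d\<^sup>2 / 2"
  proof -
    show "0 < T" "T \<le> t" using t d k by (auto simp: T_def)
    have "T \<le> d\<^sup>2 / (6 * k)" by (simp add: T_def)
    then show "3 * k * T \<le> d\<^sup>2 / 2" using k by (simp add: field_simps)
  qed
  \<comment> \<open>At time \<open>T\<close> the square has modulus at least \<open>k * T\<close>,
    so the orbit is at distance at least \<open>sqrt (k * T)\<close> from \<open>x\<close>; aperture
    4 makes its distance to the circle exceed a quarter of this.\<close>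
  define \<rho>0 where "\<rho>0 = 1 - sqrt (k * T) / 4"
  have orbit: "norm (\<phi> T (of_real r * x)) \<le> \<rho>0" if r: "0 < r" "r < 1" "(1 - r)\<^sup>2 < d\<^sup>2 / 2" for r
  proof -
    define z where "z = of_real r * x"
    have z: "norm z < 1" using r x by (simp add: z_def norm_mult)
    define \<psi> where "\<psi> = (\<lambda>s. (1 - cnj x * \<phi> s z)\<^sup>2)"
    have nphi: "norm (\<phi> s z) < 1" if "s \<ge> 0" for s using norm_phi that z by auto
    have psi0: "\<psi> 0 = of_real ((1 - r)\<^sup>2)"
    proof -
      have "cnj x * z = of_real r" using xx by (simp add: z_def mult.left_commute)
      then show ?thesis by (simp add: \<psi>_def phi_0 z)
    qed
    have dpsi: "(\<psi> has_vector_derivative V (\<phi> s z)) (at s)" if s: "s > 0" for s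
    proof -
      have "((\<lambda>u. (1 - cnj x * u)\<^sup>2) has_field_derivative 2 * (1 - cnj x * \<phi> s z) * (- cnj x)) (at (\<phi> s z))"
        by (auto intro!: derivative_eq_intros)
      from field_vector_diff_chain_at[OF flow_at[OF s z] this]
      have "(\<psi> has_vector_derivative G (\<phi> s z) * (2 * (1 - cnj x * \<phi> s z) * (- cnj x))) (at s)"
        by (simp add: \<psi>_def o_def)
      moreover have "G (\<phi> s z) * (2 * (1 - cnj x * \<phi> s z) * (- cnj x)) = V (\<phi> s z)"
      proof -
        have "G (\<phi> s z) * (2 * (cnj x * x - cnj x * \<phi> s z) * (- cnj x)) = V (\<phi> s z)"
          by (simp add: V_def power2_eq_square algebra_simps)
        then show ?thesis by (simp add: xx)
      qed
      ultimately show ?thesis by simp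
    qed
    have cpsi: "continuous_on {0..} \<psi>"
      unfolding \<psi>_def by (intro continuous_intros continuous_on_flow z)
    \<comment> \<open>Mean value inequality for \<psi> minus its expected linear motion; the
      remaining velocity is at most \<open>k\<close> as long as \<psi> is in \<Omega>.\<close>
    have est: "norm (\<psi> m - \<psi> 0 - of_real (2 * k * m)) \<le> k * m"
      if m: "m > 0" "\<And>s. 0 < s \<Longrightarrow> s < m \<Longrightarrow> \<psi> s \<in> \<Omega>" for m
    proof -
      define f where "f s = \<psi> s - s *\<^sub>R of_real (2 * k)" for s
      have "\<exists>s\<in>{0<..<m}. norm (f m - f 0) \<le> norm ((m - 0) *\<^sub>R (V (\<phi> s z) - of_real (2 * k)))"
      proof (rule mvt_general[OF m(1)])
        show "continuous_on {0..m} f"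
          unfolding f_def by (intro continuous_intros continuous_on_subset[OF cpsi]) auto
        fix s assume s: "0 < s" "s < m"
        have "(f has_vector_derivative V (\<phi> s z) - 1 *\<^sub>R of_real (2 * k)) (at s)"
          unfolding f_def by (intro derivative_intros dpsi s has_vector_derivative_diff)
            (auto intro!: derivative_eq_intros)
        then show "(f has_derivative (\<lambda>h. h *\<^sub>R (V (\<phi> s z) - of_real (2 * k)))) (at s)"
          by (simp add: has_vector_derivative_def)
      qed
      then obtain s where s: "0 < s" "s < m" "norm (f m - f 0) \<le> m * norm (V (\<phi> s z) - of_real (2 * k))"
        using m(1) by auto
      have "norm (V (\<phi> s z) - of_real (2 * k)) \<le> k"
        using V[of "\<phi> s z"] nphi[of s] m(2)[OF s(1,2)] s by (simp add: \<psi>_def)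
      then have "m * norm (V (\<phi> s z) - of_real (2 * k)) \<le> m * k" using m(1) by (intro mult_left_mono) auto
      with s(3) have "norm (f m - f 0) \<le> k * m" by (simp add: mult.commute)
      then show ?thesis by (simp add: f_def scaleR_conv_of_real algebra_simps)
    qed
    have r0: "(1 - r)\<^sup>2 > 0" using r by simp
    have step: "Re (\<psi> m) \<ge> k * m \<and> \<psi> m \<in> \<Omega>"
      if m: "m > 0" "m \<le> T" "\<And>s. 0 < s \<Longrightarrow> s < m \<Longrightarrow> \<psi> s \<in> \<Omega>" for m
    proof -
      define e where "e = \<psi> m - \<psi> 0 - of_real (2 * k * m)"
      have e: "norm e \<le> k * m" unfolding e_def by (rule est) (use m in auto)
      have psim: "\<psi> m = of_real ((1 - r)\<^sup>2 + 2 * k * m) + e" by (simp add: e_def psi0)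
      have "Re e \<ge> - norm e" using abs_Re_le_cmod[of e] by linarith
      then have 1: "Re (\<psi> m) \<ge> (1 - r)\<^sup>2 + k * m" using e by (simp add: psim)
      have "norm (\<psi> m) \<le> norm (of_real ((1 - r)\<^sup>2 + 2 * k * m) :: complex) + norm e"
        unfolding psim by (rule norm_triangle_ineq)
      also have "norm (of_real ((1 - r)\<^sup>2 + 2 * k * m) :: complex) = (1 - r)\<^sup>2 + 2 * k * m"
        unfolding norm_of_real using k m(1) by simp
      finally have "norm (\<psi> m) \<le> (1 - r)\<^sup>2 + 3 * k * m" using e by simp
      moreover have "3 * k * m \<le> 3 * k * T" using m k by (intro mult_left_mono) auto
      ultimately have "norm (\<psi> m) < d\<^sup>2" using T(3) r(3) by simp
      moreover have "k * m > 0" using k m(1) by simp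
      moreover have "k * m \<le> Re (\<psi> m)" using 1 by (rule order_trans[rotated]) simp
      ultimately show ?thesis by (simp add: \<Omega>_def)
    qed
    \<comment> \<open>A first exit time \<open>m\<close> would exist, since the times outside
      \<Omega> form a compact set. It is positive because \<psi> starts in \<Omega>, and then
      \<open>step\<close> puts \<open>\<psi> m\<close> back into \<Omega>.\<close>
    have stay: "\<psi> s \<in> \<Omega>" if s: "s \<in> {0..T}" for s
    proof (rule ccontr)
      assume "\<psi> s \<notin> \<Omega>"
      define B where "B = {0..T} \<inter> \<psi> -` (- \<Omega>)"
      have "open \<Omega>"
        unfolding \<Omega>_def by (intro open_Collect_conj open_Collect_less continuous_intros)
      then have "closed B"
        unfolding B_def
        by (intro continuous_closed_preimage continuous_on_subset[OF cpsi]) auto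
      then have "compact B" unfolding B_def
        by (metis Int_absorb2 Int_lower1 compact_Icc compact_Int_closed inf_commute)
      moreover have "s \<in> B" using s \<open>\<psi> s \<notin> \<Omega>\<close> by (simp add: B_def)
      ultimately obtain m where m: "m \<in> B" "\<And>s. s \<in> B \<Longrightarrow> m \<le> s"
        using compact_attains_inf[of B] by auto
      have "\<psi> 0 \<in> \<Omega>"
      proof -
        have "(1 - r)\<^sup>2 < d\<^sup>2" using r(3) by (rule less_le_trans) simp
        then show ?thesis using r0 by (simp add: \<Omega>_def psi0 norm_power del: of_real_power of_real_diff)
      qed
      then have "m > 0" using m(1) by (cases "m = 0") (auto simp: B_def)
      moreover have mT: "m \<le> T" using m(1) by (simp add: B_def)
      moreover have "\<psi> s \<in> \<Omega>" if "0 < s" "s < m" for s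
        using m(2)[of s] that mT by (auto simp: B_def)
      ultimately have "\<psi> m \<in> \<Omega>" using step by blast
      then show False using m(1) by (simp add: B_def)
    qed
    have ReT: "Re (\<psi> T) \<ge> k * T"
      using step[of T] stay T(1) by auto
    have zT: "norm (\<phi> T z) < 1" using nphi T by simp
    have st: "\<phi> T z \<in> stolz_angle x 4"
      using in_stolz(1)[OF zT] stay[of T] T(1) by (simp add: \<psi>_def)
    note n = norm_one_minus_cnj_mult_unit[OF x, of "\<phi> T z"]
    have "k * T \<le> norm (\<psi> T)" using ReT complex_Re_le_cmod[of "\<psi> T"] by simp
    also have "\<dots> = (norm (x - \<phi> T z))\<^sup>2" by (simp add: \<psi>_def norm_power n)
    finally have "sqrt (k * T) \<le> norm (x - \<phi> T z)" by (simp add: real_le_lsqrt)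
    then have "sqrt (k * T) < 4 * (1 - norm (\<phi> T z))" using st by (simp add: stolz_angle_iff)
    then show ?thesis by (simp add: \<rho>0_def z_def)
  qed
  have \<rho>0: "\<rho>0 < 1" using k T by (simp add: \<rho>0_def)
  \<comment> \<open>The remaining time \<open>t - T\<close> moves a compact disc to another compact
    subset of the disc, so the bound at time \<open>T\<close> carries over to
    \<open>t\<close>.\<close>
  have "compact (\<phi> (t - T) ` cball 0 \<rho>0)"
    using \<rho>0 T(2) by (intro compact_continuous_image holomorphic_on_imp_continuous_on
        holomorphic_on_subset[OF holomorphic_phi]) auto
  moreover have "\<phi> (t - T) ` cball 0 \<rho>0 \<subseteq> ball 0 1"
    using \<rho>0 T(2) norm_phi by auto
  ultimately obtain p where p: "0 \<le> p" "p < 1" "\<phi> (t - T) ` cball 0 \<rho>0 \<subseteq> cball 0 p"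
    by (rule compact_subset_unit_ball)
  have "((\<lambda>r::real. (1 - r)\<^sup>2) \<longlongrightarrow> (1 - 1)\<^sup>2) (at_left 1)" by (intro tendsto_intros)
  then have "eventually (\<lambda>r::real. (1 - r)\<^sup>2 < d\<^sup>2 / 2) (at_left 1)"
    by (rule order_tendstoD) (use d in auto)
  then have "eventually (\<lambda>r. norm (\<phi> t (of_real r * x)) \<le> p) (at_left 1)"
    using eventually_at_left_1
  proof eventually_elim
    case (elim r)
    have "norm (of_real r * x) < 1" using elim x by (simp add: norm_mult)
    then have "\<phi> t (of_real r * x) = \<phi> (t - T) (\<phi> T (of_real r * x))"
      using phi_add[of "t - T" T "of_real r * x"] T by simp
    then show ?case using orbit[of r] elim p(3) by (auto simp: image_subset_iff)
  qed
  with p(1,2) show ?thesis by (rule that)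
qed

section \<open>From a radial derivative bound to a pole\<close>

text \<open>By the identity \<open>deriv (\<phi> s) \<sigma> * G \<sigma> = G (\<phi> s
  \<sigma>)\<close>, \<open>G\<close> vanishes along the whole orbit of \<sigma>, which therefore
  has velocity 0.\<close>

lemma generator_zero_fixed:
  assumes \<sigma>: "norm \<sigma> < 1" "G \<sigma> = 0" and t: "t \<ge> 0"
  shows "\<phi> t \<sigma> = \<sigma>"
proof -
  have "((\<lambda>s. \<phi> s \<sigma>) has_vector_derivative 0) (at s within {0..})" if s: "s \<in> {0..}" for s
    using flow[of s \<sigma>] deriv_phi_mult_generator[of s \<sigma>] \<sigma> s by simp
  then obtain c where "\<And>s. s \<in> {0..} \<Longrightarrow> \<phi> s \<sigma> = c"
    using has_vector_derivative_zero_constant[of "{0..}" "\<lambda>s. \<phi> s \<sigma>"] convex_real_interval(1)[of 0]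
    by metis
  then have "\<phi> t \<sigma> = \<phi> 0 \<sigma>" using t by simp
  then show ?thesis using phi_0[OF \<sigma>(1)] by simp
qed

text \<open>\<open>\<phi> t\<close> is open and injective, so values close to
  \<open>\<phi> t p\<close> are taken only close to \<open>p\<close>, whereas the radius leaves
  every compact subset of the disc.\<close>

lemma radial_limit_not_in_image:
  assumes t: "t \<ge> 0" and x: "norm x = 1" and p: "norm p < 1"
    and lim: "((\<lambda>r. \<phi> t (of_real r * x)) \<longlongrightarrow> \<phi> t p) (at_left 1)"
  shows False
proof -
  \<comment> \<open>Points of \<open>ball p d\<close> have modulus below
    \<open>norm p + d = 1 - d\<close>, while the radial points considered have modulus above
    \<open>1 - d\<close>.\<close>
  define d where "d = (1 - norm p) / 2"
  have d: "d > 0" using p by (simp add: d_def)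
  have sub: "ball p d \<subseteq> ball 0 1"
  proof
    fix u assume "u \<in> ball p d"
    then show "u \<in> ball 0 1"
      using norm_triangle_ineq2[of u p] p by (simp add: d_def dist_norm norm_minus_commute field_simps)
  qed
  have "open (\<phi> t ` ball p d)"
    using sub by (intro open_mapping_thm3 holomorphic_on_subset[OF holomorphic_phi[OF t]]
        inj_on_subset[OF inj_on_phi[OF t]]) auto
  then have "eventually (\<lambda>r. \<phi> t (of_real r * x) \<in> \<phi> t ` ball p d) (at_left 1)"
    using d by (intro topological_tendstoD[OF lim]) auto
  moreover have "eventually (\<lambda>r::real. r > 1 - d) (at_left 1)"
    by (rule eventually_at_leftI[of "1 - d"]) (use d in auto)
  ultimately have "eventually (\<lambda>r::real. False) (at_left 1)"
    using eventually_at_left_1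
  proof eventually_elim
    case (elim r)
    then obtain u where u: "u \<in> ball p d" "\<phi> t (of_real r * x) = \<phi> t u" by auto
    have "norm (of_real r * x) = r" using elim x by (simp add: norm_mult)
    then have "of_real r * x = u"
      using inj_onD[OF inj_on_phi[OF t] u(2)] u(1) sub elim by auto
    then have "norm u = r" using \<open>norm (of_real r * x) = r\<close> by simp
    moreover have "norm u < norm p + d"
      using u(1) norm_triangle_ineq2[of u p] by (simp add: dist_norm norm_minus_commute)
    ultimately show ?case using elim(2) by (simp add: d_def field_simps)
  qed
  then show False by simp
qed

text \<open>Integration along the radius gains a second factor \<open>1 - r\<close>, so
  \<open>\<phi> t\<close> approaches its radial limit \<sigma> quadratically. This forces \<sigma>
  into the disc and away from the zeros of \<open>G\<close>; dividing \<open>G (\<phi> t z)\<close>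
  by the derivative then bounds \<open>G\<close> from below.\<close>

lemma pole_of_radial_deriv_bound:
  assumes t: "t > 0" and x: "norm x = 1"
    and bd: "eventually (\<lambda>r. norm (deriv (\<phi> t) (of_real r * x)) / (1 - r) \<le> M) (at_left 1)"
  obtains c where "c > 0" "eventually (\<lambda>r. c \<le> norm (G (of_real r * x)) * (1 - r)) (at_left 1)"
proof -
  have t0: "t \<ge> 0" using t by simp
  \<comment> \<open>The maximum with 1 makes the constant positive, for use as a Lipschitz constant
    and as a divisor.\<close>
  define N where "N = max M 1"
  have N: "N > 0" "M \<le> N" by (auto simp: N_def)
  define f where "f = (\<lambda>r. \<phi> t (of_real r * x))"
  obtain b' where b': "b' < 1"
      "\<And>r. r > b' \<Longrightarrow> r < 1 \<Longrightarrow> norm (deriv (\<phi> t) (of_real r * x)) / (1 - r) \<le> M"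
    using bd unfolding eventually_at_left_field by blast
  define b where "b = max b' 0"
  have b: "0 \<le> b" "b < 1" "b' \<le> b" using b'(1) by (auto simp: b_def)
  have db: "norm (deriv (\<phi> t) (of_real r * x)) \<le> N * (1 - r)" if "b < r" "r < 1" for r
  proof -
    have "norm (deriv (\<phi> t) (of_real r * x)) / (1 - r) \<le> N"
      using b'(2)[of r] that b N by (meson le_less_trans order_trans)
    then show ?thesis using that by (simp add: pos_divide_le_eq)
  qed
  have fd: "norm (f r - f s) \<le> N * (1 - r) * (s - r)" if rs: "b < r" "r \<le> s" "s < 1" for r s
    unfolding f_def
  proof (rule radial_difference_bound[OF holomorphic_phi[OF t0] x])
    fix u assume u: "r \<le> u" "u \<le> s"
    have "norm (deriv (\<phi> t) (of_real u * x)) \<le> N * (1 - u)" using u rs by (intro db) auto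
    also have "\<dots> \<le> N * (1 - r)" using u N by (intro mult_left_mono) auto
    finally show "norm (deriv (\<phi> t) (of_real u * x)) \<le> N * (1 - r)" .
  qed (use rs b in auto)
  have fd': "norm (f r - f s) \<le> N * (s - r)" if rs: "b < r" "r \<le> s" "s < 1" for r s
  proof -
    have "N * (1 - r) \<le> N * 1" using rs b N by (intro mult_left_mono) auto
    then have "N * (1 - r) * (s - r) \<le> N * (s - r)" using rs by (intro mult_right_mono) auto
    with fd[OF rs] show ?thesis by linarith
  qed
  have "N-lipschitz_on {b<..<1} f"
  proof (rule lipschitz_onI)
    show "dist (f r) (f s) \<le> N * dist r s" if "r \<in> {b<..<1}" "s \<in> {b<..<1}" for r s
      using that fd'[of r s] fd'[of s r]
      by (cases "r \<le> s") (auto simp: dist_norm norm_minus_commute)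
  qed (use N in auto)
  then have "uniformly_continuous_on {b<..<1} f" by (rule lipschitz_on_uniformly_continuous)
  moreover have "1 \<in> closure {b<..<1}" using b by simp
  ultimately obtain \<sigma> where "(f \<longlongrightarrow> \<sigma>) (at 1 within {b<..<1})"
    by (rule uniformly_continuous_on_extension_at_closure)
  moreover have "at (1::real) within {b<..<1} = at_left 1"
    by (rule at_within_nhd[of _ "{b<..}"]) (use b in auto)
  ultimately have lim: "(f \<longlongrightarrow> \<sigma>) (at_left 1)" by simp
  have fless: "norm (f r) < 1" if "b < r" "r < 1" for r
    unfolding f_def using that b x by (intro norm_phi t0) (simp add: norm_mult)
  have eb: "eventually (\<lambda>r. b < r \<and> r < 1) (at_left 1)"
    by (rule eventually_at_leftI[of b]) (use b in auto)
  have f\<sigma>: "norm (f r - \<sigma>) \<le> N * (1 - r) * (1 - r)" if r: "b < r" "r < 1" for r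
  proof (rule tendsto_le)
    show "((\<lambda>s. norm (f r - f s)) \<longlongrightarrow> norm (f r - \<sigma>)) (at_left 1)" by (intro tendsto_intros lim)
    show "((\<lambda>s. N * (1 - r) * (s - r)) \<longlongrightarrow> N * (1 - r) * (1 - r)) (at_left 1)" by (intro tendsto_intros)
    show "eventually (\<lambda>s. norm (f r - f s) \<le> N * (1 - r) * (s - r)) (at_left 1)"
      by (rule eventually_at_leftI[of r]) (use fd r in auto)
  qed simp
  have "norm \<sigma> \<le> 1"
  proof (rule tendsto_upperbound)
    show "((\<lambda>r. norm (f r)) \<longlongrightarrow> norm \<sigma>) (at_left 1)" by (intro tendsto_intros lim)
    show "eventually (\<lambda>r. norm (f r) \<le> 1) (at_left 1)"
      using eb by eventually_elim (use fless in \<open>auto intro: less_imp_le\<close>)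
  qed simp
  \<comment> \<open>On the circle, the linear lower bound \<open>\<kappa> * (1 - r)\<close> for
    \<open>1 - norm (f r)\<close> would contradict the quadratic upper bound
    \<open>N * (1 - r) * (1 - r)\<close>.\<close>
  moreover have "norm \<sigma> \<noteq> 1"
  proof
    assume \<sigma>: "norm \<sigma> = 1"
    obtain \<kappa> where \<kappa>: "\<kappa> > 0" "\<And>z. norm z < 1 \<Longrightarrow> \<kappa> * (1 - norm z) \<le> 1 - norm (\<phi> t z)"
      using self_map_boundary_distance[OF holomorphic_phi[OF t0] phi_image[OF t0]] by metis
    have "\<kappa> \<le> N * (1 - r)" if r: "b < r" "r < 1" for r
    proof -
      have nr: "norm (of_real r * x) = r" using r b x by (simp add: norm_mult)
      have "\<kappa> * (1 - r) \<le> 1 - norm (f r)" using \<kappa>(2)[of "of_real r * x"] nr r by (simp add: f_def)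
      also have "\<dots> \<le> norm (f r - \<sigma>)" using norm_triangle_ineq2[of \<sigma> "f r"] \<sigma> by (simp add: norm_minus_commute)
      also have "\<dots> \<le> N * (1 - r) * (1 - r)" by (rule f\<sigma>[OF r])
      finally show ?thesis using r by simp
    qed
    then have low: "eventually (\<lambda>r. \<kappa> \<le> N * (1 - r)) (at_left 1)" using eb by (auto elim: eventually_mono)
    have "((\<lambda>r. N * (1 - r)) \<longlongrightarrow> N * (1 - 1)) (at_left 1)" by (intro tendsto_intros)
    from tendsto_lowerbound[OF this low] have "\<kappa> \<le> N * (1 - 1)" by simp
    then show False using \<kappa>(1) by simp
  qed
  ultimately have \<sigma>: "norm \<sigma> < 1" by linarith
  \<comment> \<open>A zero of \<open>G\<close> is fixed by \<open>\<phi> t\<close>, so the radial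
    limit \<sigma> would itself be a value of \<open>\<phi> t\<close> in the disc.\<close>
  have "G \<sigma> \<noteq> 0"
  proof
    assume "G \<sigma> = 0"
    then have "\<phi> t \<sigma> = \<sigma>" by (rule generator_zero_fixed[OF \<sigma> _ t0])
    then have "((\<lambda>r. \<phi> t (of_real r * x)) \<longlongrightarrow> \<phi> t \<sigma>) (at_left 1)"
      using lim by (simp only: f_def)
    then show False by (rule radial_limit_not_in_image[OF t0 x \<sigma>])
  qed
  have "isCont G \<sigma>"
    using holomorphic_on_imp_continuous_on[OF holomorphic_G] \<sigma> by (simp add: continuous_on_eq_continuous_at)
  from tendsto_norm[OF isCont_tendsto_compose[OF this lim]]
  have "eventually (\<lambda>r. norm (G \<sigma>) / 2 < norm (G (f r))) (at_left 1)"
    by (rule order_tendstoD) (use \<open>G \<sigma> \<noteq> 0\<close> in simp)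
  then have "eventually (\<lambda>r. norm (G \<sigma>) / (2 * N) \<le> norm (G (of_real r * x)) * (1 - r)) (at_left 1)"
    using eb
  proof eventually_elim
    case (elim r)
    have "norm (of_real r * x) < 1" using elim b x by (simp add: norm_mult)
    then have "norm (G (f r)) = norm (deriv (\<phi> t) (of_real r * x)) * norm (G (of_real r * x))"
      using deriv_phi_mult_generator[OF t0, of "of_real r * x"] by (simp add: f_def norm_mult[symmetric])
    also have "\<dots> \<le> N * (1 - r) * norm (G (of_real r * x))"
      using db[of r] elim by (intro mult_right_mono) auto
    finally have "norm (G \<sigma>) / 2 \<le> N * (1 - r) * norm (G (of_real r * x))" using elim(1) by simp
    then show ?case using N(1) by (simp add: field_simps)
  qed
  moreover have "norm (G \<sigma>) / (2 * N) > 0" using N \<open>G \<sigma> \<noteq> 0\<close> by simp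
  ultimately show ?thesis by (rule that[rotated])
qed

section \<open>Boundary behaviour of the semigroup at a pole\<close>

text \<open>In each angle \<open>\<phi> t\<close> stays in a compact set while \<open>G\<close> is
  bounded away from 0, so the derivative \<open>G (\<phi> t z) / G z\<close> is bounded. On the
  convex end of the angle \<open>\<phi> t\<close> is then Lipschitz and extends to \<open>x\<close>.
  The second limit follows from writing the quotient as
  \<open>G (\<phi> t z) / (G z * (z - x))\<close>.\<close>

lemma angular_behaviour_at_pole:
  assumes x: "norm x = 1" and k: "k > 0"
    and lim: "angular_lim (\<lambda>z. G z * (z - x)) x (of_real k * x\<^sup>2)" and t: "t > 0"
  obtains \<sigma> where "norm \<sigma> < 1" "angular_lim (\<phi> t) x \<sigma>"
    "angular_lim (\<lambda>z. deriv (\<phi> t) z / (z - x)) x (G \<sigma> / (of_real k * x\<^sup>2))"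
proof -
  have t0: "t \<ge> 0" using t by simp
  obtain \<rho> where \<rho>: "0 \<le> \<rho>" "\<rho> < 1" "eventually (\<lambda>r. norm (\<phi> t (of_real r * x)) \<le> \<rho>) (at_left 1)"
    by (rule radial_orbits_enter_compact[OF x k lim t])
  have ex: "\<exists>\<sigma>. norm \<sigma> < 1 \<and> (\<phi> t \<longlongrightarrow> \<sigma>) (at x within stolz_angle x R)" if R: "R > 1" for R
  proof -
    obtain \<rho>' where \<rho>': "\<rho>' < 1" "eventually (\<lambda>z. norm (\<phi> t z) \<le> \<rho>') (at x within stolz_angle x R)"
      by (rule self_map_bounded_in_stolz_angle[OF holomorphic_phi[OF t0] phi_image[OF t0] x \<rho> R])
    have "compact (G ` cball 0 \<rho>')"
      using \<rho>'(1) by (intro compact_continuous_image holomorphic_on_imp_continuous_on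
          holomorphic_on_subset[OF holomorphic_G]) auto
    then obtain M where M: "\<And>u. u \<in> cball 0 \<rho>' \<Longrightarrow> norm (G u) \<le> M"
      by (meson bounded_iff compact_imp_bounded image_eqI)
    have "((\<lambda>z. norm (G z * (z - x))) \<longlongrightarrow> norm (of_real k * x\<^sup>2)) (at x within stolz_angle x R)"
      by (intro tendsto_norm angular_limD[OF lim] R)
    then have "eventually (\<lambda>z. k / 2 < norm (G z * (z - x))) (at x within stolz_angle x R)"
      by (rule order_tendstoD) (use k x in \<open>simp add: norm_mult norm_power\<close>)
    \<comment> \<open>Within distance 1 of \<open>x\<close>, dropping the factor
      \<open>norm (z - x)\<close> only increases the value, so \<open>norm (G z)\<close> is itself
      at least \<open>k / 2\<close>.\<close>
    moreover have "eventually (\<lambda>z. dist z x < 1) (at x within stolz_angle x R)"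
      unfolding eventually_at by (intro exI[of _ 1]) auto
    ultimately have "eventually (\<lambda>z. norm (deriv (\<phi> t) z) \<le> 2 * \<bar>M\<bar> / k) (at x within stolz_angle x R)"
      using \<rho>'(2) eventually_in_stolz_angle[of x R]
    proof eventually_elim
      case (elim z)
      have z: "norm z < 1" using elim(4) by (simp add: stolz_angle_iff)
      have "norm (G z) * norm (z - x) \<le> norm (G z) * 1"
        using elim(2) by (intro mult_left_mono) (auto simp: dist_norm)
      then have "k / 2 \<le> norm (G z)" using elim(1) by (simp add: norm_mult)
      then have "norm (deriv (\<phi> t) z) * (k / 2) \<le> norm (deriv (\<phi> t) z) * norm (G z)"
        by (intro mult_left_mono) auto
      also have "\<dots> = norm (G (\<phi> t z))"
        using deriv_phi_mult_generator[OF t0 z] by (simp flip: norm_mult)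
      also have "\<dots> \<le> \<bar>M\<bar>" using M[of "\<phi> t z"] elim(3) by simp
      finally show ?case using k by (simp add: field_simps)
    qed
    with \<rho>'(2) have "eventually (\<lambda>z. norm (\<phi> t z) \<le> \<rho>' \<and> norm (deriv (\<phi> t) z) \<le> 2 * \<bar>M\<bar> / k) (at x within stolz_angle x R)"
      by (rule eventually_conj)
    then obtain d where d: "d > 0" "\<And>z. z \<in> stolz_angle x R \<Longrightarrow> z \<noteq> x \<Longrightarrow> dist z x < d \<Longrightarrow> norm (deriv (\<phi> t) z) \<le> 2 * \<bar>M\<bar> / k"
      unfolding eventually_at by blast
    define S where "S = stolz_angle x R \<inter> ball x d"
    have Sx: "norm z < 1" "z \<noteq> x" if "z \<in> S" for z using that x by (auto simp: S_def stolz_angle_iff)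
    have "(2 * \<bar>M\<bar> / k)-lipschitz_on S (\<phi> t)"
    proof (rule lipschitz_onI)
      fix z w assume zw: "z \<in> S" "w \<in> S"
      have "norm (\<phi> t z - \<phi> t w) \<le> 2 * \<bar>M\<bar> / k * norm (z - w)"
      proof (rule field_differentiable_bound[of S "\<phi> t" "deriv (\<phi> t)"])
        show "convex S" unfolding S_def using R by (intro convex_Int convex_stolz_angle) auto
        fix u assume u: "u \<in> S"
        show "(\<phi> t has_field_derivative deriv (\<phi> t) u) (at u within S)"
          using phi_has_field_derivative[OF t0 Sx(1)[OF u]] by (rule has_field_derivative_at_within)
        show "norm (deriv (\<phi> t) u) \<le> 2 * \<bar>M\<bar> / k"
          using d(2)[of u] Sx[OF u] u by (auto simp: S_def dist_commute)
      qed (use zw in auto)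
      then show "dist (\<phi> t z) (\<phi> t w) \<le> 2 * \<bar>M\<bar> / k * dist z w" by (simp add: dist_norm)
    qed (use k in auto)
    then have "uniformly_continuous_on S (\<phi> t)" by (rule lipschitz_on_uniformly_continuous)
    moreover have atS: "at x within S = at x within stolz_angle x R"
      unfolding S_def by (rule at_within_nhd[of _ "ball x d"]) (use d in auto)
    moreover have "x \<in> closure S"
    proof -
      have "at x within S \<noteq> bot" using atS at_within_stolz_angle_neq_bot[OF x R] by simp
      then show ?thesis by (simp add: closure_def trivial_limit_within)
    qed
    ultimately obtain \<sigma> where \<sigma>: "(\<phi> t \<longlongrightarrow> \<sigma>) (at x within stolz_angle x R)"
      using uniformly_continuous_on_extension_at_closure by metis
    have "norm \<sigma> \<le> \<rho>'"
      using tendsto_norm[OF \<sigma>] \<rho>'(2) at_within_stolz_angle_neq_bot[OF x R] by (rule tendsto_upperbound)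
    then show ?thesis using \<sigma> \<rho>'(1) by (intro exI[of _ \<sigma>]) auto
  qed
  obtain \<sigma> where \<sigma>: "norm \<sigma> < 1" "(\<phi> t \<longlongrightarrow> \<sigma>) (at x within stolz_angle x 2)"
    using ex[of 2] by auto
  \<comment> \<open>The limit obtained so far might depend on the aperture. All angles contain the
    end of the radius, so each limit equals the radial one.\<close>
  have lim\<sigma>: "angular_lim (\<phi> t) x \<sigma>"
    unfolding angular_lim_def
  proof (intro allI impI)
    fix R :: real assume R: "R > 1"
    obtain \<tau> where \<tau>: "(\<phi> t \<longlongrightarrow> \<tau>) (at x within stolz_angle x R)" using ex[OF R] by blast
    have "((\<lambda>r. \<phi> t (of_real r * x)) \<longlongrightarrow> \<tau>) (at_left 1)"
      by (rule filterlim_compose[OF \<tau> filterlim_radius[OF x R]])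
    moreover have "((\<lambda>r. \<phi> t (of_real r * x)) \<longlongrightarrow> \<sigma>) (at_left 1)"
      by (rule filterlim_compose[OF \<sigma>(2) filterlim_radius[OF x]]) simp
    ultimately have "\<tau> = \<sigma>" by (intro tendsto_unique[of "at_left (1::real)"]) auto
    with \<tau> show "(\<phi> t \<longlongrightarrow> \<sigma>) (at x within stolz_angle x R)" by simp
  qed
  have "angular_lim (\<lambda>z. deriv (\<phi> t) z / (z - x)) x (G \<sigma> / (of_real k * x\<^sup>2))"
    unfolding angular_lim_def
  proof (intro allI impI)
    fix R :: real assume R: "R > 1"
    have kx: "of_real k * x\<^sup>2 \<noteq> 0" using k x by auto
    have nz: "eventually (\<lambda>z. G z * (z - x) \<noteq> 0) (at x within stolz_angle x R)"
      using topological_tendstoD[OF angular_limD[OF lim R], of "- {0}"] kx by (simp add: open_Compl)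
    have "isCont G \<sigma>"
      using holomorphic_on_imp_continuous_on[OF holomorphic_G] \<sigma> by (simp add: continuous_on_eq_continuous_at)
    then have "((\<lambda>z. G (\<phi> t z)) \<longlongrightarrow> G \<sigma>) (at x within stolz_angle x R)"
      by (rule isCont_tendsto_compose) (rule angular_limD[OF lim\<sigma> R])
    then have "((\<lambda>z. G (\<phi> t z) / (G z * (z - x))) \<longlongrightarrow> G \<sigma> / (of_real k * x\<^sup>2)) (at x within stolz_angle x R)"
      by (intro tendsto_divide angular_limD[OF lim R] kx)
    moreover have "eventually (\<lambda>z. G (\<phi> t z) / (G z * (z - x)) = deriv (\<phi> t) z / (z - x)) (at x within stolz_angle x R)"
      using nz eventually_in_stolz_angle[of x R]
    proof eventually_elim
      case (elim z)
      then have "G (\<phi> t z) = G z * deriv (\<phi> t) z"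
        using deriv_phi_mult_generator[OF t0, of z] by (simp add: stolz_angle_iff mult.commute)
      then show ?case using elim by simp
    qed
    ultimately show "((\<lambda>z. deriv (\<phi> t) z / (z - x)) \<longlongrightarrow> G \<sigma> / (of_real k * x\<^sup>2)) (at x within stolz_angle x R)"
      by (rule Lim_transform_eventually)
  qed
  with \<sigma>(1) lim\<sigma> show ?thesis by (rule that)
qed

lemma tendsto_radial_generator:
  assumes x: "norm x = 1" and k: "k \<ge> 0"
    and lim: "angular_lim (\<lambda>z. G z * (z - x)) x (of_real k * x\<^sup>2)"
  shows "((\<lambda>r. norm (G (of_real r * x)) * (1 - r)) \<longlongrightarrow> k) (at_left 1)"
proof -
  have "((\<lambda>r. norm (G (of_real r * x) * (of_real r * x - x))) \<longlongrightarrow> norm (of_real k * x\<^sup>2)) (at_left 1)"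
    by (intro tendsto_norm angular_lim_radial[OF lim x])
  moreover have "eventually (\<lambda>r. norm (G (of_real r * x) * (of_real r * x - x)) = norm (G (of_real r * x)) * (1 - r)) (at_left 1)"
    using eventually_at_left_1
    by eventually_elim (use x in \<open>simp add: norm_mult norm_diff_radius norm_minus_commute[of _ x]\<close>)
  moreover have "norm (of_real k * x\<^sup>2) = k" using x k by (simp add: norm_mult norm_power)
  ultimately show ?thesis using Lim_transform_eventually by fastforce
qed

end

subsection \<open>Regular poles and boundary behaviour of the derivatives\<close>

lemma all_equivalentI:
  assumes "\<And>P. P \<in> set Ps \<Longrightarrow> P \<longleftrightarrow> Q"
  shows "all_equivalent Ps"
  unfolding all_equivalent_def using assms by blast

text \<open>The single aperture 2 suffices: its angle contains the radius, on which
  \<open>norm (x - z) = 1 - r\<close>.\<close>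

lemma radial_deriv_bound_of_beta_point:
  assumes "beta_point f x" "norm x = 1"
  obtains M where "eventually (\<lambda>r. norm (deriv f (of_real r * x)) / (1 - r) \<le> M) (at_left 1)"
proof -
  have "Limsup (at x within stolz_angle x 2) (\<lambda>z. ereal (norm (deriv f z) / norm (x - z))) < \<infinity>"
    using assms(1) unfolding beta_point_def angular_limsup_def
    by (rule le_less_trans[rotated]) (rule SUP_upper, simp)
  then obtain M where "eventually (\<lambda>z. norm (deriv f z) / norm (x - z) \<le> M) (at x within stolz_angle x 2)"
    unfolding Limsup_ereal_finite_iff by blast
  then have "eventually (\<lambda>r. norm (deriv f (of_real r * x)) / norm (x - of_real r * x) \<le> M) (at_left 1)"
    by (rule eventually_compose_filterlim) (rule filterlim_radius[OF assms(2)], simp)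
  then have "eventually (\<lambda>r. norm (deriv f (of_real r * x)) / (1 - r) \<le> M) (at_left 1)"
    using eventually_at_left_1
    by eventually_elim (simp add: norm_diff_radius[OF assms(2)])
  then show ?thesis by (rule that)
qed

text \<open>Integrate the second derivative from \<open>r\<close> to \<open>s\<close> and let
  \<open>s\<close> tend to 1; the first derivative at \<open>s\<close> drops out in the
  limit.\<close>

lemma radial_deriv_bound_of_second_deriv_bound:
  assumes f: "f holomorphic_on ball 0 1" and x: "norm x = 1"
    and lim: "((\<lambda>r. norm (deriv f (of_real r * x))) \<longlongrightarrow> 0) (at_left 1)"
    and ls: "Limsup (at_left 1) (\<lambda>r. ereal (norm ((deriv ^^ 2) f (of_real r * x)))) < \<infinity>"
  obtains M where "eventually (\<lambda>r. norm (deriv f (of_real r * x)) / (1 - r) \<le> M) (at_left 1)"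
proof -
  obtain M where "eventually (\<lambda>r. norm (deriv (deriv f) (of_real r * x)) \<le> M) (at_left 1)"
    using ls unfolding Limsup_ereal_finite_iff by (auto simp: numeral_2_eq_2)
  then obtain b where b: "b < 1" "\<And>r. r > b \<Longrightarrow> r < 1 \<Longrightarrow> norm (deriv (deriv f) (of_real r * x)) \<le> M"
    unfolding eventually_at_left_field by blast
  have "norm (deriv f (of_real r * x)) / (1 - r) \<le> M" if r: "max b 0 < r" "r < 1" for r
  proof -
    have diff: "norm (deriv f (of_real r * x)) \<le> M * (s - r) + norm (deriv f (of_real s * x))" if s: "r < s" "s < 1" for s
    proof -
      have "norm (deriv f (of_real r * x) - deriv f (of_real s * x)) \<le> M * (s - r)"
        using r s b by (intro radial_difference_bound holomorphic_deriv f x) auto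
      then show ?thesis
        using norm_triangle_ineq2[of "deriv f (of_real r * x)" "deriv f (of_real s * x)"] by linarith
    qed
    have "((\<lambda>s. M * (s - r) + norm (deriv f (of_real s * x))) \<longlongrightarrow> M * (1 - r) + 0) (at_left 1)"
      by (intro tendsto_intros lim)
    moreover have "eventually (\<lambda>s. norm (deriv f (of_real r * x)) \<le> M * (s - r) + norm (deriv f (of_real s * x))) (at_left 1)"
      by (rule eventually_at_leftI[of r]) (use diff r in auto)
    ultimately have "norm (deriv f (of_real r * x)) \<le> M * (1 - r) + 0"
      by (rule tendsto_lowerbound) simp
    then show ?thesis using r by (simp add: pos_divide_le_eq)
  qed
  then have "eventually (\<lambda>r. norm (deriv f (of_real r * x)) / (1 - r) \<le> M) (at_left 1)"
    using b(1) by (intro eventually_at_leftI[of "max b 0"]) auto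
  then show ?thesis by (rule that)
qed

lemma radial_conditions_of_angular:
  assumes x: "norm x = 1"
    and "angular_lim (deriv f) x 0" "angular_lim ((deriv ^^ 2) f) x L"
  shows "((\<lambda>r. norm (deriv f (of_real r * x))) \<longlongrightarrow> 0) (at_left 1)"
    "Limsup (at_left 1) (\<lambda>r. ereal (norm ((deriv ^^ 2) f (of_real r * x)))) < \<infinity>"
proof -
  show "((\<lambda>r. norm (deriv f (of_real r * x))) \<longlongrightarrow> 0) (at_left 1)"
    using tendsto_norm[OF angular_lim_radial[OF assms(2) x]] by simp
  have "((\<lambda>r. ereal (norm ((deriv ^^ 2) f (of_real r * x)))) \<longlongrightarrow> ereal (norm L)) (at_left 1)"
    using tendsto_norm[OF angular_lim_radial[OF assms(3) x]] by simp
  then have "Limsup (at_left 1) (\<lambda>r. ereal (norm ((deriv ^^ 2) f (of_real r * x)))) = ereal (norm L)"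
    by (intro lim_imp_Limsup) auto
  then show "Limsup (at_left 1) (\<lambda>r. ereal (norm ((deriv ^^ 2) f (of_real r * x)))) < \<infinity>" by simp
qed

text \<open>Each clause "for some, equivalently for all" contributes two entries to the list, so
  both readings are among the conditions shown equivalent.\<close>

theorem theorem4p1:
  fixes G :: "complex \<Rightarrow> complex" and \<phi> :: "real \<Rightarrow> complex \<Rightarrow> complex" and x :: complex
  assumes "holomorphic_semigroup \<phi>"
    and "infinitesimal_generator_of \<phi> G"
    and "x \<in> sphere 0 1"
  shows
    "all_equivalent
       [Limsup (at_left 1) (\<lambda>r::real. ereal (norm (G (of_real r * x)) * (1 - r))) > 0,
        regular_pole G x,
        \<exists>t>0. beta_point (\<phi> t) x,
        \<forall>t>0. beta_point (\<phi> t) x,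
        \<exists>t>0. angular_lim (deriv (\<phi> t)) x 0 \<and> (\<exists>L. angular_lim ((deriv ^^ 2) (\<phi> t)) x L),
        \<forall>t>0. angular_lim (deriv (\<phi> t)) x 0 \<and> (\<exists>L. angular_lim ((deriv ^^ 2) (\<phi> t)) x L),
        \<exists>t>0. ((\<lambda>r::real. norm (deriv (\<phi> t) (of_real r * x))) \<longlongrightarrow> 0) (at_left 1) \<and>
               Limsup (at_left 1) (\<lambda>r::real. ereal (norm ((deriv ^^ 2) (\<phi> t) (of_real r * x)))) < \<infinity>,
        \<forall>t>0. ((\<lambda>r::real. norm (deriv (\<phi> t) (of_real r * x))) \<longlongrightarrow> 0) (at_left 1) \<and>
               Limsup (at_left 1) (\<lambda>r::real. ereal (norm ((deriv ^^ 2) (\<phi> t) (of_real r * x)))) < \<infinity>,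
        \<exists>t\<^sub>0>0. Limsup (at_left 1)
                 (\<lambda>r::real. ereal (norm (deriv (\<phi> t\<^sub>0) (of_real r * x)) / (1 - r))) < \<infinity>]
     \<and>
     (regular_pole G x \<longrightarrow>
       (\<exists>A. angular_lim (\<lambda>z. G z * (z - x)) x A \<and>
            regular_pole_of_mass G x (norm A) \<and>
            (\<forall>t>0. \<exists>\<sigma>\<in>ball 0 1.
               angular_lim (\<phi> t) x \<sigma> \<and>
               angular_lim (deriv (\<phi> t)) x 0 \<and>
               angular_lim ((deriv ^^ 2) (\<phi> t)) x (G \<sigma> / A) \<and>
               angular_lim (\<lambda>z. deriv (\<phi> t) z / (z - x)) x (G \<sigma> / A))))"
proof -
  interpret semigroup_with_generator \<phi> G
    using assms by unfold_locales
  have x: "norm x = 1" using assms(3) by simp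
  obtain k where k: "k \<ge> 0" and lim: "angular_lim (\<lambda>z. G z * (z - x)) x (of_real k * x\<^sup>2)"
    by (rule angular_lim_generator[OF x])
  define A where "A = of_real k * x\<^sup>2"
  have nA: "norm A = k" using k x by (simp add: A_def norm_mult norm_power)
  note rad = tendsto_radial_generator[OF x k lim]
  have "((\<lambda>r. ereal (norm (G (of_real r * x)) * (1 - r))) \<longlongrightarrow> ereal k) (at_left 1)"
    using rad by simp
  then have "Limsup (at_left 1) (\<lambda>r. ereal (norm (G (of_real r * x)) * (1 - r))) = ereal k"
    by (intro lim_imp_Limsup) auto
  then have c1: "Limsup (at_left 1) (\<lambda>r. ereal (norm (G (of_real r * x)) * (1 - r))) > 0 \<longleftrightarrow> k > 0"
    by simp
  have "angular_liminf (\<lambda>z. norm (G z * (x - z))) x = ereal k"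
  proof (rule angular_liminf_eq[OF _ x])
    fix R :: real assume "R > 1"
    from tendsto_norm[OF angular_limD[OF lim this]]
    show "((\<lambda>z. norm (G z * (x - z))) \<longlongrightarrow> k) (at x within stolz_angle x R)"
      using nA by (simp add: norm_mult norm_minus_commute[of _ x] A_def)
  qed
  then have mass: "regular_pole_of_mass G x C \<longleftrightarrow> C > 0 \<and> C = k" for C
    by (auto simp: regular_pole_of_mass_def)
  then have c2: "regular_pole G x \<longleftrightarrow> k > 0" by (auto simp: regular_pole_def)
  \<comment> \<open>Common target of the converse implications: \<beta>-points, second derivative
    bounds and the last condition all reduce to this radial bound at one time.\<close>
  have pole: "k > 0" if t: "t > 0"
    and bd: "eventually (\<lambda>r. norm (deriv (\<phi> t) (of_real r * x)) / (1 - r) \<le> M) (at_left 1)" for t M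
  proof -
    obtain c where c: "c > 0" "eventually (\<lambda>r. c \<le> norm (G (of_real r * x)) * (1 - r)) (at_left 1)"
      by (rule pole_of_radial_deriv_bound[OF t x bd])
    have "c \<le> k" by (rule tendsto_lowerbound[OF rad c(2)]) simp
    then show ?thesis using c(1) by simp
  qed
  have behaviour: "\<exists>\<sigma>\<in>ball 0 1. angular_lim (\<phi> t) x \<sigma> \<and> angular_lim (deriv (\<phi> t)) x 0 \<and>
      angular_lim ((deriv ^^ 2) (\<phi> t)) x (G \<sigma> / A) \<and>
      angular_lim (\<lambda>z. deriv (\<phi> t) z / (z - x)) x (G \<sigma> / A)" if kp: "k > 0" and t: "t > 0" for t
  proof -
    obtain \<sigma> where \<sigma>: "norm \<sigma> < 1" "angular_lim (\<phi> t) x \<sigma>"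
      and q: "angular_lim (\<lambda>z. deriv (\<phi> t) z / (z - x)) x (G \<sigma> / A)"
      unfolding A_def by (rule angular_behaviour_at_pole[OF x kp lim t])
    \<comment> \<open>\<open>angular_lim_deriv\<close> is applied to the derivative of
      \<open>\<phi> t\<close>, so the one quotient limit yields the limits of both the first and the
      second derivative.\<close>
    have "deriv (\<phi> t) holomorphic_on ball 0 1"
      using t by (intro holomorphic_deriv holomorphic_phi) auto
    from angular_lim_deriv[OF this x q] show ?thesis
      using \<sigma> q by (auto simp: numeral_2_eq_2)
  qed
  have q: "\<exists>L. angular_lim (\<lambda>z. deriv (\<phi> t) z / (z - x)) x L" if "k > 0" "t > 0" for t
    using behaviour[OF that] by blast
  have beta: "beta_point (\<phi> t) x" if "k > 0" "t > 0" for t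
  proof -
    obtain L where L: "angular_lim (\<lambda>z. deriv (\<phi> t) z / (z - x)) x L" using q \<open>k > 0\<close> \<open>t > 0\<close> by blast
    have "angular_limsup (\<lambda>z. norm (deriv (\<phi> t) z) / norm (x - z)) x = ereal (norm L)"
    proof (rule angular_limsup_eq[OF _ x])
      fix R :: real assume "R > 1"
      from tendsto_norm[OF angular_limD[OF L this]]
      show "((\<lambda>z. norm (deriv (\<phi> t) z) / norm (x - z)) \<longlongrightarrow> norm L) (at x within stolz_angle x R)"
        by (simp add: norm_divide norm_minus_commute[of _ x])
    qed
    then show ?thesis by (simp add: beta_point_def)
  qed
  have ang: "angular_lim (deriv (\<phi> t)) x 0 \<and> (\<exists>L. angular_lim ((deriv ^^ 2) (\<phi> t)) x L)" if "k > 0" "t > 0" for t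
    using behaviour[OF that] by blast
  have beta_imp: "k > 0" if "t > 0" "beta_point (\<phi> t) x" for t
    by (rule radial_deriv_bound_of_beta_point[OF that(2) x]) (rule pole[OF that(1)])
  have rad_imp: "k > 0" if "t > 0" "((\<lambda>r. norm (deriv (\<phi> t) (of_real r * x))) \<longlongrightarrow> 0) (at_left 1)"
      "Limsup (at_left 1) (\<lambda>r. ereal (norm ((deriv ^^ 2) (\<phi> t) (of_real r * x)))) < \<infinity>" for t
    by (rule radial_deriv_bound_of_second_deriv_bound[OF holomorphic_phi x that(2,3)])
      (use that(1) pole[OF that(1)] in auto)
  have ang_rad: "((\<lambda>r. norm (deriv (\<phi> t) (of_real r * x))) \<longlongrightarrow> 0) (at_left 1) \<and>
      Limsup (at_left 1) (\<lambda>r. ereal (norm ((deriv ^^ 2) (\<phi> t) (of_real r * x)))) < \<infinity>"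
    if "angular_lim (deriv (\<phi> t)) x 0 \<and> (\<exists>L. angular_lim ((deriv ^^ 2) (\<phi> t)) x L)" for t
    using that radial_conditions_of_angular[OF x] by blast
  \<comment> \<open>Here and below, a condition at one time gives \<open>k > 0\<close>, and
    \<open>k > 0\<close> gives the condition at all times; time 1 serves as the sample.\<close>
  have c3: "(\<exists>t>0. beta_point (\<phi> t) x) \<longleftrightarrow> k > 0"
    using beta[of 1] beta_imp by (auto intro: exI[of _ 1])
  have c4: "(\<forall>t>0. beta_point (\<phi> t) x) \<longleftrightarrow> k > 0"
    using beta beta_imp[of 1] by auto
  have c5: "(\<exists>t>0. angular_lim (deriv (\<phi> t)) x 0 \<and> (\<exists>L. angular_lim ((deriv ^^ 2) (\<phi> t)) x L)) \<longleftrightarrow> k > 0"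
    using ang[of 1] ang_rad rad_imp by (meson zero_less_one)
  have c6: "(\<forall>t>0. angular_lim (deriv (\<phi> t)) x 0 \<and> (\<exists>L. angular_lim ((deriv ^^ 2) (\<phi> t)) x L)) \<longleftrightarrow> k > 0"
    using ang ang_rad[of 1] rad_imp[of 1] by (meson zero_less_one)
  have c7: "(\<exists>t>0. ((\<lambda>r. norm (deriv (\<phi> t) (of_real r * x))) \<longlongrightarrow> 0) (at_left 1) \<and>
      Limsup (at_left 1) (\<lambda>r. ereal (norm ((deriv ^^ 2) (\<phi> t) (of_real r * x)))) < \<infinity>) \<longleftrightarrow> k > 0"
    using ang[of 1] ang_rad[of 1] rad_imp by (meson zero_less_one)
  have c8: "(\<forall>t>0. ((\<lambda>r. norm (deriv (\<phi> t) (of_real r * x))) \<longlongrightarrow> 0) (at_left 1) \<and>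
      Limsup (at_left 1) (\<lambda>r. ereal (norm ((deriv ^^ 2) (\<phi> t) (of_real r * x)))) < \<infinity>) \<longleftrightarrow> k > 0"
    using ang ang_rad rad_imp[of 1] by (meson zero_less_one)
  have c9: "(\<exists>t>0. Limsup (at_left 1) (\<lambda>r. ereal (norm (deriv (\<phi> t) (of_real r * x)) / (1 - r))) < \<infinity>) \<longleftrightarrow> k > 0"
    unfolding Limsup_ereal_finite_iff
    using pole radial_deriv_bound_of_beta_point[OF beta[of 1] x] by (meson zero_less_one)
  show ?thesis
    unfolding c1 c2 c3 c4 c5 c6 c7 c8 c9
  proof (intro conjI impI all_equivalentI)
    fix P assume "P \<in> set [k > 0, k > 0, k > 0, k > 0, k > 0, k > 0, k > 0, k > 0, k > 0]"
    then show "P \<longleftrightarrow> k > 0" by simp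
  next
    assume "k > 0"
    then show "\<exists>A. angular_lim (\<lambda>z. G z * (z - x)) x A \<and> regular_pole_of_mass G x (norm A) \<and>
      (\<forall>t>0. \<exists>\<sigma>\<in>ball 0 1. angular_lim (\<phi> t) x \<sigma> \<and> angular_lim (deriv (\<phi> t)) x 0 \<and>
        angular_lim ((deriv ^^ 2) (\<phi> t)) x (G \<sigma> / A) \<and>
        angular_lim (\<lambda>z. deriv (\<phi> t) z / (z - x)) x (G \<sigma> / A))"
      using lim nA mass behaviour by (intro exI[of _ A]) (auto simp: A_def[symmetric])
  qed
qed

end
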